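(* Let $\theta\in(0,2\pi)$ be an irrational algebraic multiple of $\pi$ (i.e. $\theta/\pi$ is an irrational algebraic number). Then $\rho_\xi\colon F_2\to\mathrm{PSL}(2,\mathbb{R})$ is faithful (injective) for a very general point $\xi\in\mathfrak{C}_\theta$.
   Context: $F_2=\langle X,Y,Z\mid XYZ=1\rangle$ is the free group on $X,Y$, identified with $\pi_1(M)$ for $M$ a once-punctured torus. For $\theta\in(0,2\pi)$, the Fricke--Klein space $\mathfrak{C}_\theta$ of marked incomplete hyperbolic structures on $M$ with a single cone point of angle $\theta$ at the puncture is identified with $$\mathfrak{C}_\theta=\{(x,y,z)\in(2,\infty)^3\mid x^2+y^2+z^2-xyz-2=-2\cos(\theta/2)\}$$ (with the subspace topology), where $x,y,z$ are the absolute values of the traces of the holonomies of $X,Y,Z$. For $\xi=(x,y,z)\in\mathfrak{C}_\theta$ the holonomy map $\rho_\xi\colon F_2\to\mathrm{PSL}(2,\mathbb{R})$ is well defined up to conjugation; up to conjugation by an isometry of $\mathbb{H}^2$ it is the projection to $\mathrm{PSL}(2,\mathbb{R})$ of the representation $\tilde\rho_\xi\colon F_2\to \mathrm{SL}(2,\mathbb{R})$ given by $$\tilde\rho_\xi(X)=\begin{pmatrix}x&-1\\1&0\end{pmatrix},\quad \tilde\rho_\xi(Y)=\begin{pmatrix}0&\zeta^{-1}\\-\zeta&y\end{pmatrix},\quad \zeta\ge1,\ \zeta+\zeta^{-1}=z,$$ for which $\mathrm{tr}\,\tilde\rho_\xi(X)=x$, $\mathrm{tr}\,\tilde\rho_\xi(Y)=y$,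 $\mathrm{tr}\,\tilde\rho_\xi(Z)=z$. A statement holds for a very general point of a topological space $A$ if it holds for all points of some dense $G_\delta$ subset of $A$. *)

theory Defs
  imports
    "HOL-Analysis.Analysis"
    "HOL-Algebra.Coset"
    "HOL-Computational_Algebra.Polynomial"
begin

section \<open>Groups given by generators and relators\<close>

datatype 'a letter = Gen 'a | Inv 'a

primrec letter_inverse :: "'a letter \<Rightarrow> 'a letter" where
  "letter_inverse (Gen a) = Inv a"
| "letter_inverse (Inv a) = Gen a"

text \<open>
  The least congruence on words that identifies a letter times its inverse, and every relator
  in \<open>R\<close>, with the empty word.
\<close>

inductive word_equiv :: "'a letter list set \<Rightarrow> 'a letter list \<Rightarrow> 'a letter list \<Rightarrow> bool"
  for R :: "'a letter list set"
where
  word_refl: "word_equiv R u u"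
| word_sym: "word_equiv R u v \<Longrightarrow> word_equiv R v u"
| word_trans: "word_equiv R u v \<Longrightarrow> word_equiv R v w \<Longrightarrow> word_equiv R u w"
| word_cancel: "word_equiv R (u @ [l, letter_inverse l] @ v) (u @ v)"
| word_relator: "r \<in> R \<Longrightarrow> word_equiv R (u @ r @ v) (u @ v)"

definition word_class :: "'a letter list set \<Rightarrow> 'a letter list \<Rightarrow> 'a letter list set" where
  "word_class R w = {v. word_equiv R w v}"

definition presented_group :: "'a letter list set \<Rightarrow> 'a letter list set monoid" where
  "presented_group R =
     \<lparr>carrier = range (word_class R),
      mult = (\<lambda>A B. \<Union>a\<in>A. \<Union>b\<in>B. word_class R (a @ b)),
      one = word_class R []\<rparr>"

lemma word_equiv_context:
  "word_equiv R u v \<Longrightarrow> word_equiv R (p @ u @ q) (p @ v @ q)"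
proof (induction rule: word_equiv.induct)
  case (word_cancel u l v)
  show ?case using word_equiv.word_cancel[of R "p @ u" l "v @ q"] by simp
next
  case (word_relator r u v)
  then show ?case using word_equiv.word_relator[of r R "p @ u" "v @ q"] by simp
qed (blast intro: word_equiv.intros)+

lemma word_equiv_append:
  assumes "word_equiv R u u'" "word_equiv R v v'"
  shows "word_equiv R (u @ v) (u' @ v')"
  using word_equiv_context[OF assms(1), of "[]" v] word_equiv_context[OF assms(2), of u' "[]"]
  by (auto intro: word_trans)

lemma word_class_eq_iff: "word_class R u = word_class R v \<longleftrightarrow> word_equiv R u v"
  unfolding word_class_def by (blast intro: word_equiv.intros)

lemma word_class_self: "w \<in> word_class R w"
  by (simp add: word_class_def word_refl)

lemma carrier_presented_group: "carrier (presented_group R) = range (word_class R)"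
  by (simp add: presented_group_def)

lemma one_presented_group: "\<one>\<^bsub>presented_group R\<^esub> = word_class R []"
  by (simp add: presented_group_def)

lemma mult_presented_group:
  "word_class R u \<otimes>\<^bsub>presented_group R\<^esub> word_class R v = word_class R (u @ v)"
proof -
  have "word_class R (a @ b) = word_class R (u @ v)"
    if "a \<in> word_class R u" "b \<in> word_class R v" for a b
    using that word_sym[OF word_equiv_append[of R u a v b]]
    by (subst word_class_eq_iff) (simp add: word_class_def)
  then have "(\<Union>a\<in>word_class R u. \<Union>b\<in>word_class R v. word_class R (a @ b))
      = (\<Union>a\<in>word_class R u. \<Union>b\<in>word_class R v. word_class R (u @ v))"
    by (intro SUP_cong refl)
  also have "\<dots> = word_class R (u @ v)"
    using word_class_self[of u R] word_class_self[of v R] by blast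
  finally show ?thesis by (simp add: presented_group_def)
qed

lemma letter_inverse_inverse [simp]: "letter_inverse (letter_inverse l) = l"
  by (cases l) auto

lemma word_equiv_inverse:
  "word_equiv R (rev (map letter_inverse w) @ w) []"
proof (induction w)
  case (Cons l w)
  show ?case
    using word_cancel[of R "rev (map letter_inverse w)" "letter_inverse l" w] Cons
    by (auto intro: word_trans)
qed (auto intro: word_refl)

lemma group_presented_group: "group (presented_group R)"
proof (rule groupI)
  fix x assume "x \<in> carrier (presented_group R)"
  then obtain w where w: "x = word_class R w"
    by (auto simp: carrier_presented_group)
  have "word_class R (rev (map letter_inverse w)) \<otimes>\<^bsub>presented_group R\<^esub> x = \<one>\<^bsub>presented_group R\<^esub>"
    by (simp add: w mult_presented_group one_presented_group word_class_eq_iff word_equiv_inverse)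
  then show "\<exists>y\<in>carrier (presented_group R). y \<otimes>\<^bsub>presented_group R\<^esub> x = \<one>\<^bsub>presented_group R\<^esub>"
    by (auto simp: carrier_presented_group)
qed (auto simp: carrier_presented_group one_presented_group mult_presented_group)

primrec letter_value :: "('g, 'b) monoid_scheme \<Rightarrow> ('a \<Rightarrow> 'g) \<Rightarrow> 'a letter \<Rightarrow> 'g" where
  "letter_value G f (Gen a) = f a"
| "letter_value G f (Inv a) = inv\<^bsub>G\<^esub> f a"

primrec word_value :: "('g, 'b) monoid_scheme \<Rightarrow> ('a \<Rightarrow> 'g) \<Rightarrow> 'a letter list \<Rightarrow> 'g" where
  "word_value G f [] = \<one>\<^bsub>G\<^esub>"
| "word_value G f (l # w) = letter_value G f l \<otimes>\<^bsub>G\<^esub> word_value G f w"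

text \<open>
  The homomorphism that sends each generator \<open>a\<close> to \<open>f a\<close>. It is meaningful when \<open>f\<close> kills the
  relators: then \<open>word_value G f\<close> is constant on every class.
\<close>

definition induced_map :: "('g, 'b) monoid_scheme \<Rightarrow> ('a \<Rightarrow> 'g) \<Rightarrow> 'a letter list set \<Rightarrow> 'g" where
  "induced_map G f A = the_elem (word_value G f ` A)"

context group
begin

lemma letter_value_closed: "range f \<subseteq> carrier G \<Longrightarrow> letter_value G f l \<in> carrier G"
  by (cases l) auto

lemma word_value_closed: "range f \<subseteq> carrier G \<Longrightarrow> word_value G f w \<in> carrier G"
  by (induction w) (auto simp: letter_value_closed)

lemma word_value_append:
  "range f \<subseteq> carrier G \<Longrightarrow> word_value G f (u @ v) = word_value G f u \<otimes> word_value G f v"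
  by (induction u) (auto simp: letter_value_closed word_value_closed m_assoc)

lemma letter_value_inverse:
  assumes "range f \<subseteq> carrier G"
  shows "letter_value G f l \<otimes> letter_value G f (letter_inverse l) = \<one>"
  using assms by (cases l) (auto simp: range_subsetD)

lemma word_value_equiv:
  assumes f: "range f \<subseteq> carrier G" and R: "\<And>r. r \<in> R \<Longrightarrow> word_value G f r = \<one>"
    and "word_equiv R u v"
  shows "word_value G f u = word_value G f v"
  using assms(3)
proof (induction rule: word_equiv.induct)
  case (word_cancel u l v)
  have "letter_value G f l \<otimes> (letter_value G f (letter_inverse l) \<otimes> word_value G f v)
      = word_value G f v"
    using f by (simp flip: m_assoc add: letter_value_closed word_value_closed letter_value_inverse)
  then show ?case using f by (simp add: word_value_append)
next
  case (word_relator r u v)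
  then show ?case using f R by (simp add: word_value_append word_value_closed)
qed auto

lemma induced_map_class:
  assumes "range f \<subseteq> carrier G" "\<And>r. r \<in> R \<Longrightarrow> word_value G f r = \<one>"
  shows "induced_map G f (word_class R w) = word_value G f w"
proof -
  have "word_value G f v = word_value G f w" if "v \<in> word_class R w" for v
    using that word_value_equiv[OF assms, of R w v] by (simp add: word_class_def)
  then have "word_value G f ` word_class R w = {word_value G f w}"
    using word_class_self[of w R] by blast
  then show ?thesis by (simp add: induced_map_def)
qed

lemma induced_map_hom:
  assumes "range f \<subseteq> carrier G" "\<And>r. r \<in> R \<Longrightarrow> word_value G f r = \<one>"
  shows "induced_map G f \<in> hom (presented_group R) G"
  using assms
  by (auto simp: hom_def carrier_presented_group mult_presented_group induced_map_class
      word_value_append word_value_closed)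

end


section \<open>The fundamental group of the once-punctured torus\<close>

datatype generator = GX | GY | GZ

definition F2_relators :: "generator letter list set" where
  "F2_relators = {[Gen GX, Gen GY, Gen GZ]}"

abbreviation F2 :: "generator letter list set monoid" where
  "F2 \<equiv> presented_group F2_relators"

definition F2_gen :: "generator \<Rightarrow> generator letter list set" where
  "F2_gen a = word_class F2_relators [Gen a]"

text \<open>The values of \<open>X\<close>, \<open>Y\<close> determine that of \<open>Z = (XY)\<^sup>-\<^sup>1\<close>.\<close>

primrec F2_images :: "('g, 'b) monoid_scheme \<Rightarrow> 'g \<Rightarrow> 'g \<Rightarrow> generator \<Rightarrow> 'g" where
  "F2_images G a b GX = a"
| "F2_images G a b GY = b"
| "F2_images G a b GZ = inv\<^bsub>G\<^esub> (a \<otimes>\<^bsub>G\<^esub> b)"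

definition F2_hom :: "('g, 'b) monoid_scheme \<Rightarrow> 'g \<Rightarrow> 'g \<Rightarrow> generator letter list set \<Rightarrow> 'g" where
  "F2_hom G a b = induced_map G (F2_images G a b)"

lemma (in group) F2_images_ok:
  assumes "a \<in> carrier G" "b \<in> carrier G"
  shows "range (F2_images G a b) \<subseteq> carrier G"
    and "r \<in> F2_relators \<Longrightarrow> word_value G (F2_images G a b) r = \<one>"
proof -
  show "range (F2_images G a b) \<subseteq> carrier G"
  proof clarify
    fix g show "F2_images G a b g \<in> carrier G" using assms by (cases g) auto
  qed
  show "word_value G (F2_images G a b) r = \<one>" if "r \<in> F2_relators"
    using that assms by (auto simp: F2_relators_def simp flip: m_assoc)
qed

text \<open>\<open>F2\<close> is free on \<open>X\<close> and \<open>Y\<close>: the universal property.\<close>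

lemma (in group) F2_hom:
  assumes "a \<in> carrier G" "b \<in> carrier G"
  shows "F2_hom G a b \<in> hom F2 G"
    and "F2_hom G a b (F2_gen GX) = a"
    and "F2_hom G a b (F2_gen GY) = b"
    and "F2_hom G a b (F2_gen GZ) = inv (a \<otimes> b)"
  using assms F2_images_ok[OF assms]
  by (auto simp: F2_hom_def F2_gen_def induced_map_class intro: induced_map_hom)

lemma (in group) F2_hom_unique:
  assumes h: "h \<in> hom F2 G" and w: "w \<in> carrier F2"
  shows "h w = F2_hom G (h (F2_gen GX)) (h (F2_gen GY)) w"
proof -
  interpret F: group F2 by (rule group_presented_group)
  interpret h: group_hom F2 G h by unfold_locales (rule h)
  let ?f = "F2_images G (h (F2_gen GX)) (h (F2_gen GY))"
  have gen: "F2_gen g \<in> carrier F2" for g by (auto simp: F2_gen_def carrier_presented_group)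
  note ok = F2_images_ok[OF h.hom_closed[OF gen[of GX]] h.hom_closed[OF gen[of GY]]]
  have rel: "word_equiv F2_relators [Gen GX, Gen GY, Gen GZ] []"
    using word_relator[of "[Gen GX, Gen GY, Gen GZ]" F2_relators "[]" "[]"]
    by (simp add: F2_relators_def)
  have "(F2_gen GX \<otimes>\<^bsub>F2\<^esub> F2_gen GY) \<otimes>\<^bsub>F2\<^esub> F2_gen GZ = \<one>\<^bsub>F2\<^esub>"
    using rel by (simp add: F2_gen_def mult_presented_group one_presented_group word_class_eq_iff)
  then have "inv\<^bsub>F2\<^esub> F2_gen GZ = F2_gen GX \<otimes>\<^bsub>F2\<^esub> F2_gen GY"
    by (rule F.inv_equality) (simp_all add: gen)
  then have "F2_gen GZ = inv\<^bsub>F2\<^esub> (F2_gen GX \<otimes>\<^bsub>F2\<^esub> F2_gen GY)"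
    using F.inv_inv[OF gen[of GZ]] by simp
  then have hg: "h (F2_gen g) = ?f g" for g
    using gen by (cases g) auto
  have hl: "h (word_class F2_relators [l]) = letter_value G ?f l" for l
  proof (cases l)
    case (Gen g)
    then show ?thesis using hg[of g] by (simp flip: F2_gen_def)
  next
    case (Inv g)
    have "word_equiv F2_relators [Inv g, Gen g] []"
      using word_cancel[of F2_relators "[]" "Inv g" "[]"] by simp
    then have "word_class F2_relators [Inv g] = inv\<^bsub>F2\<^esub> F2_gen g"
      using gen by (intro F.inv_equality[symmetric])
        (auto simp: F2_gen_def mult_presented_group one_presented_group word_class_eq_iff
          carrier_presented_group)
    then show ?thesis using Inv gen[of g] hg[of g] by simp
  qed
  have "h (word_class F2_relators u) = word_value G ?f u" for u
  proof (induction u)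
    case Nil then show ?case using h.hom_one by (simp add: one_presented_group)
  next
    case (Cons l u)
    have "h (word_class F2_relators [l] \<otimes>\<^bsub>F2\<^esub> word_class F2_relators u)
        = letter_value G ?f l \<otimes> word_value G ?f u"
      unfolding Cons.IH[symmetric] hl[of l, symmetric]
      by (rule h.hom_mult) (auto simp: carrier_presented_group)
    then show ?case by (simp add: mult_presented_group)
  qed
  moreover obtain u where "w = word_class F2_relators u"
    using w by (auto simp: carrier_presented_group)
  ultimately show ?thesis
    unfolding F2_hom_def using induced_map_class[OF ok, of F2_relators u] by simp
qed


section \<open>The groups \<open>SL(2,\<real>)\<close> and \<open>PSL(2,\<real>)\<close>\<close>

definition SL2R :: "(real^2^2) monoid" where
  "SL2R = \<lparr>carrier = {A. det A = 1}, mult = (**), one = mat 1\<rparr>"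

definition PSL2R :: "(real^2^2) set monoid" where
  "PSL2R = SL2R Mod {mat 1, - mat 1}"

definition PSL2R_proj :: "real^2^2 \<Rightarrow> (real^2^2) set" where
  "PSL2R_proj A = {mat 1, - mat 1} #>\<^bsub>SL2R\<^esub> A"

lemma SL2R_simps [simp]:
  "carrier SL2R = {A. det A = 1}" "A \<otimes>\<^bsub>SL2R\<^esub> B = A ** B" "\<one>\<^bsub>SL2R\<^esub> = mat 1"
  by (simp_all add: SL2R_def)

lemma group_SL2R: "group SL2R"
proof (rule groupI)
  fix A assume "A \<in> carrier SL2R"
  then have d: "det A = 1" by simp
  then have "invertible A" by (simp add: invertible_det_nz)
  then obtain B where B: "B ** A = mat 1" by (auto simp: invertible_def)
  have "det B = 1" using arg_cong[OF B, of det] d by (simp add: det_mul)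
  with B show "\<exists>B\<in>carrier SL2R. B \<otimes>\<^bsub>SL2R\<^esub> A = \<one>\<^bsub>SL2R\<^esub>" by auto
qed (auto simp: det_mul matrix_mul_assoc)

lemma neg_matrix_mul: "- A ** B = - (A ** B)" "A ** - B = - (A ** (B :: real^2^2))"
  for A :: "real^2^2"
  by (auto simp: vec_eq_iff matrix_matrix_mult_def sum_negf)

lemma PSL2R_proj_eq: "PSL2R_proj A = {A, - A}"
  by (auto simp: PSL2R_proj_def r_coset_def neg_matrix_mul)

lemma det_neg_2: "det (- A) = det (A :: real^2^2)"
  by (simp add: det_2)

lemma normal_PSL2R_center: "{mat 1, - mat 1} \<lhd> SL2R"
proof -
  interpret group SL2R by (rule group_SL2R)
  have "subgroup {mat 1, - mat 1} SL2R"
  proof (rule subgroupI)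
    fix A :: "real^2^2" assume A: "A \<in> {mat 1, - mat 1}"
    then have "A ** A = mat 1" by (auto simp: neg_matrix_mul)
    then have "inv\<^bsub>SL2R\<^esub> A = A" using A by (intro inv_equality) (auto simp: det_neg_2)
    with A show "inv\<^bsub>SL2R\<^esub> A \<in> {mat 1, - mat 1}" by simp
  qed (auto simp: det_neg_2 neg_matrix_mul)
  then show ?thesis
    by (rule normalI) (auto simp: r_coset_def l_coset_def neg_matrix_mul)
qed

lemma group_PSL2R: "group PSL2R"
  unfolding PSL2R_def by (rule normal.factorgroup_is_group[OF normal_PSL2R_center])

lemma PSL2R_proj_hom: "PSL2R_proj \<in> hom SL2R PSL2R"
  using normal.r_coset_hom_Mod[OF normal_PSL2R_center]
  unfolding PSL2R_def PSL2R_proj_def[abs_def] .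


section \<open>Cone structures and their holonomies\<close>

definition fricke_klein :: "real \<Rightarrow> (real \<times> real \<times> real) set" where
  "fricke_klein \<theta> = {(x, y, z). x > 2 \<and> y > 2 \<and> z > 2 \<and>
     x^2 + y^2 + z^2 - x * y * z - 2 = - 2 * cos (\<theta> / 2)}"

definition zeta_of :: "real \<Rightarrow> real" where
  "zeta_of z = (THE \<zeta>. \<zeta> \<ge> 1 \<and> \<zeta> + inverse \<zeta> = z)"

lemma zeta_of_eq:
  assumes "z \<ge> 2"
  shows "zeta_of z = (z + sqrt (z^2 - 4)) / 2"
    and "zeta_of z \<ge> 1" "zeta_of z + inverse (zeta_of z) = z"
proof -
  define s where "s = sqrt (z^2 - 4)"
  have "2 * 2 \<le> z * z" using assms by (intro mult_mono) auto
  then have s: "s * s = z * z - 4" "s \<ge> 0" by (auto simp: s_def power2_eq_square)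
  have 1: "(z + s) / 2 \<ge> 1" using assms s by simp
  have p: "(z + s) / 2 * ((z - s) / 2) = 1" using s by (simp add: field_simps)
  then have 2: "(z + s) / 2 + inverse ((z + s) / 2) = z"
    using inverse_unique[OF p] by (simp add: field_simps)
  have u: "t = (z + s) / 2" if "t \<ge> 1" "t + inverse t = z" for t
  proof (rule ccontr)
    assume n: "t \<noteq> (z + s) / 2"
    define q where "q = (z + s) / 2"
    have q: "q \<ge> 1" "t + inverse t = q + inverse q" using 1 2 that(2) by (simp_all add: q_def)
    then have "t * q * (t + inverse t) = t * q * (q + inverse q)" by simp
    then have "t * t * q + q = t * q * q + t"
      using that(1) q(1) by (simp add: distrib_left mult_ac)
    then have "(t - q) * (t * q - 1) = 0" by (simp add: algebra_simps)
    with n have tq: "t * q = 1" by (simp add: q_def)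
    have "t * 1 \<le> t * q" "1 * q \<le> t * q" using that(1) q(1) by (intro mult_mono; simp)+
    then have "t = 1" "q = 1" using that(1) q(1) tq by auto
    with n show False by (simp add: q_def)
  qed
  have e: "zeta_of z = (z + s) / 2"
    unfolding zeta_of_def using 1 2 u by (intro the_equality) auto
  show "zeta_of z = (z + sqrt (z^2 - 4)) / 2" using e by (simp add: s_def)
  show "zeta_of z \<ge> 1" "zeta_of z + inverse (zeta_of z) = z" unfolding e by (rule 1, rule 2)
qed

definition holonomy_X :: "real \<times> real \<times> real \<Rightarrow> real^2^2" where
  "holonomy_X = (\<lambda>(x, y, z). vector [vector [x, - 1], vector [1, 0]])"

definition holonomy_Y :: "real \<times> real \<times> real \<Rightarrow> real^2^2" where
  "holonomy_Y = (\<lambda>(x, y, z). vector [vector [0, inverse (zeta_of z)], vector [- zeta_of z, y]])"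

definition holonomy_lift :: "real \<times> real \<times> real \<Rightarrow> generator letter list set \<Rightarrow> real^2^2" where
  "holonomy_lift \<xi> = F2_hom SL2R (holonomy_X \<xi>) (holonomy_Y \<xi>)"

text \<open>
  The holonomy of a point is a conjugacy class of homomorphisms. The isometries of the hyperbolic
  plane form \<open>PGL(2,\<real>)\<close>, acting on \<open>PSL(2,\<real>)\<close> by conjugation, where \<open>det g < 0\<close> gives the
  orientation-reversing ones. Every representative that the normal form allows is included; the
  image of the coset \<open>{A, -A}\<close> is the coset of the conjugated matrix.
\<close>

definition holonomies :: "real \<times> real \<times> real \<Rightarrow> (generator letter list set \<Rightarrow> (real^2^2) set) set" where
  "holonomies \<xi> = {\<rho>. \<exists>g :: real^2^2. invertible g \<and>
     (\<forall>w\<in>carrier F2. \<rho> w = (\<lambda>A. g ** A ** matrix_inv g) ` PSL2R_proj (holonomy_lift \<xi> w))}"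

lemma holonomy_det:
  assumes "z \<ge> 2"
  shows "det (holonomy_X (x, y, z)) = 1" "det (holonomy_Y (x, y, z)) = 1"
  using zeta_of_eq(2)[OF assms] by (simp_all add: holonomy_X_def holonomy_Y_def det_2)

lemma holonomy_lift:
  assumes "z \<ge> 2"
  shows "holonomy_lift (x, y, z) \<in> hom F2 SL2R"
    and "holonomy_lift (x, y, z) (F2_gen GX) = vector [vector [x, - 1], vector [1, 0]]"
    and "holonomy_lift (x, y, z) (F2_gen GY) =
           vector [vector [0, inverse (zeta_of z)], vector [- zeta_of z, y]]"
  using group.F2_hom[OF group_SL2R, of "holonomy_X (x, y, z)" "holonomy_Y (x, y, z)"]
    holonomy_det[OF assms]
  by (simp_all add: holonomy_lift_def holonomy_X_def holonomy_Y_def)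

lemma trace_holonomy_lift:
  assumes "z \<ge> 2"
  shows "trace (holonomy_lift (x, y, z) (F2_gen GX)) = x"
    and "trace (holonomy_lift (x, y, z) (F2_gen GY)) = y"
    and "trace (holonomy_lift (x, y, z) (F2_gen GZ)) = z"
proof -
  show "trace (holonomy_lift (x, y, z) (F2_gen GX)) = x"
       "trace (holonomy_lift (x, y, z) (F2_gen GY)) = y"
    using holonomy_lift(2,3)[OF assms] by (simp_all add: trace_def sum_2)
  let ?P = "holonomy_X (x, y, z) ** holonomy_Y (x, y, z)"
  let ?Q = "vector [vector [?P$2$2, - ?P$1$2], vector [- ?P$2$1, ?P$1$1]] :: real^2^2"
  interpret group SL2R by (rule group_SL2R)
  have d: "det ?P = 1" by (simp add: det_mul holonomy_det[OF assms])
  then have "?Q ** ?P = mat 1" "det ?Q = 1"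
    by (auto simp: det_2 vec_eq_iff forall_2 matrix_matrix_mult_def sum_2 mat_def algebra_simps)
  then have "inv\<^bsub>SL2R\<^esub> ?P = ?Q" using d by (intro inv_equality) auto
  then have "holonomy_lift (x, y, z) (F2_gen GZ) = ?Q"
    using F2_hom(4)[of "holonomy_X (x, y, z)" "holonomy_Y (x, y, z)"] holonomy_det[OF assms]
    by (simp add: holonomy_lift_def)
  moreover have "?P$1$1 + ?P$2$2 = z"
    using zeta_of_eq(3)[OF assms]
    by (simp add: holonomy_X_def holonomy_Y_def matrix_matrix_mult_def sum_2)
  ultimately show "trace (holonomy_lift (x, y, z) (F2_gen GZ)) = z"
    by (simp add: trace_def sum_2)
qed

lemma matrix_inv_mult:
  assumes "invertible (g :: real^2^2)"
  shows "g ** matrix_inv g = mat 1" "matrix_inv g ** g = mat 1"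
  using someI_ex[OF assms[unfolded invertible_def]] by (simp_all add: matrix_inv_def)

lemma standard_holonomy:
  "(\<lambda>w. PSL2R_proj (holonomy_lift \<xi> w)) \<in> holonomies \<xi>"
proof -
  have inv: "invertible (mat 1 :: real^2^2)" by (auto simp: invertible_def)
  moreover have "matrix_inv (mat 1 :: real^2^2) = mat 1"
    using matrix_inv_mult(1)[OF inv] by simp
  ultimately show ?thesis
    unfolding holonomies_def by (intro CollectI exI[of _ "mat 1"]) auto
qed

lemma holonomies_hom:
  assumes "z \<ge> 2" "\<rho> \<in> holonomies (x, y, z)"
  shows "\<rho> \<in> hom F2 PSL2R"
proof -
  obtain g :: "real^2^2" where g: "invertible g" and
    \<rho>: "\<And>w. w \<in> carrier F2 \<Longrightarrow>
        \<rho> w = (\<lambda>A. g ** A ** matrix_inv g) ` PSL2R_proj (holonomy_lift (x, y, z) w)"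
    using assms(2) by (auto simp: holonomies_def)
  define c where "c = (\<lambda>A. g ** A ** matrix_inv g)"
  have gi: "g ** matrix_inv g = mat 1" "matrix_inv g ** g = mat 1"
    using matrix_inv_mult[OF g] by auto
  have c_mult: "c (A ** B) = c A ** c B" for A B
  proof -
    have "c A ** c B = g ** A ** (matrix_inv g ** g) ** B ** matrix_inv g"
      by (simp add: c_def matrix_mul_assoc)
    then show ?thesis by (simp add: gi c_def matrix_mul_assoc)
  qed
  have c_det: "det (c A) = det A" for A
    using arg_cong[OF gi(1), of det] by (simp add: c_def det_mul mult_ac)
  have c: "c \<in> hom SL2R SL2R" by (auto simp: hom_def c_mult c_det)
  have "c ` PSL2R_proj A = PSL2R_proj (c A)" for A
    by (simp add: PSL2R_proj_eq c_def neg_matrix_mul)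
  then have eq: "\<rho> w = (PSL2R_proj \<circ> (c \<circ> holonomy_lift (x, y, z))) w" if "w \<in> carrier F2" for w
    using \<rho>[OF that] by (simp add: c_def)
  have "PSL2R_proj \<circ> (c \<circ> holonomy_lift (x, y, z)) \<in> hom F2 PSL2R"
    by (rule Group.hom_compose[OF Group.hom_compose[OF holonomy_lift(1)[OF assms(1)] c]
          PSL2R_proj_hom])
  moreover have "a \<otimes>\<^bsub>F2\<^esub> b \<in> carrier F2" if "a \<in> carrier F2" "b \<in> carrier F2" for a b
    using that group_presented_group[of F2_relators] by (simp add: group.is_monoid monoid.m_closed)
  ultimately show ?thesis using eq by (simp add: hom_def Pi_iff)
qed


section \<open>Very general points\<close>

definition very_general :: "'a topology \<Rightarrow> ('a \<Rightarrow> bool) \<Rightarrow> bool" where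
  "very_general T P \<longleftrightarrow>
     (\<exists>D. gdelta_in T D \<and> Abstract_Topology.closure_of T D = topspace T \<and> (\<forall>\<xi>\<in>D. P \<xi>))"

end

theory Submission
  imports Defs "HOL-Algebra.Generated_Groups" "HOL-Real_Asymp.Real_Asymp"
begin

text \<open>
  The surface is rationally parametrized by the eigenvalue \<open>x\<close> of \<open>X\<close> and a twist parameter \<open>t\<close>
  along \<open>X\<close>, so a word that is trivial on an open subset is trivial everywhere, and by Baire it
  suffices to find for each word \<open>w \<noteq> 1\<close> one point where \<open>w\<close> is not trivial. Write \<open>F\<^sub>2\<close> as the HNN
  extension with vertex group \<open>\<langle>X, YXY\<^sup>-\<^sup>1\<rangle>\<close> and stable letter \<open>Y\<close>. As \<open>t \<rightarrow> \<infinity>\<close> a word without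
  pinches that contains \<open>Y\<close> grows like a power of \<open>t\<close>, provided that certain matrix entries of
  elements of the vertex group are nonzero. The vertex group is \<open>\<langle>X\<rangle> * \<langle>[X, Y]\<rangle>\<close>, and as \<open>x \<rightarrow> \<infinity>\<close> the
  image of \<open>[X, Y]\<close> converges to an elliptic element of angle incommensurable with \<open>\<pi>\<close>, no
  nontrivial power of which has a zero entry, whereas powers of \<open>X\<close> converge projectively to
  coordinate projections; hence these entries are nonzero for large \<open>x\<close>.
\<close>


section \<open>Two-by-two matrices\<close>

text \<open>The commutator \<open>[X, Y]\<close> is elliptic of infinite order at every point of the
  surface, so the images are never discrete and neither a fundamental domain nor ping-pong on the
  hyperbolic plane is at hand. Nontriviality is read off from growth rates instead. The two limits
  are taken in a fixed order. The limit in t is taken at a fixed x. The vertex group does not see t,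
  so all that one of its elements contributes there is whether a single matrix entry vanishes. A
  word poses finitely many such conditions, and each holds for all large x; hence one x, depending
  on the word, meets all of them. Origin of the constants: the trace of \<open>[X, Y]\<close> is x^2
  + y^2 + z^2 - xyz - 2 in terms of the traces of X, Y, Z. On the surface this is -2 cos(theta/2) =
  2 cos(pi - theta/2). Hence K = 2 + 2 cos(theta/2) is 2 minus this trace, and phi = pi - theta/2 is
  the angle whose multiples must avoid the multiples of pi.\<close>

definition mat2 :: "real \<Rightarrow> real \<Rightarrow> real \<Rightarrow> real \<Rightarrow> real^2^2" where
  "mat2 a b c d = vector [vector [a, b], vector [c, d]]"

lemma mat2_nth [simp]:
  "mat2 a b c d $ 1 $ 1 = a" "mat2 a b c d $ 1 $ 2 = b"
  "mat2 a b c d $ 2 $ 1 = c" "mat2 a b c d $ 2 $ 2 = d"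
  by (simp_all add: mat2_def)

lemma mat2_eqI:
  assumes "A$1$1 = B$1$1" "A$1$2 = B$1$2" "A$2$1 = B$2$1" "A$2$2 = B$2$2"
  shows "A = (B :: real^2^2)"
  using assms by (simp add: vec_eq_iff forall_2)

lemma matrix_mult_nth2: "(A ** B) $ i $ j = A$i$1 * B$1$j + A$i$2 * B$2$j"
  for A B :: "real^2^2"
  by (simp add: matrix_matrix_mult_def sum_2)

lemma matrix_vector_mult_nth2: "(A *v u) $ i = A$i$1 * u$1 + A$i$2 * u$2"
  for A :: "real^2^2"
  by (simp add: matrix_vector_mult_def sum_2)

lemma mat_1_nth2 [simp]:
  "(mat 1 :: real^2^2) $ 1 $ 1 = 1" "(mat 1 :: real^2^2) $ 1 $ 2 = 0"
  "(mat 1 :: real^2^2) $ 2 $ 1 = 0" "(mat 1 :: real^2^2) $ 2 $ 2 = 1"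
  by (simp_all add: mat_def)

lemma det_mat2 [simp]: "det (mat2 a b c d) = a * d - b * c"
  by (simp add: det_2)

lemma inv_SL2R:
  assumes "det A = 1"
  shows "inv\<^bsub>SL2R\<^esub> A = mat2 (A$2$2) (- A$1$2) (- A$2$1) (A$1$1)"
proof -
  interpret group SL2R by (rule group_SL2R)
  show ?thesis
    using assms by (intro inv_equality)
      (auto simp: det_2 matrix_mult_nth2 algebra_simps intro!: mat2_eqI)
qed

lemma pm_mat_1_iff:
  "A = mat 1 \<or> A = - mat 1 \<longleftrightarrow> A$1$2 = 0 \<and> A$2$1 = 0 \<and> A$1$1 - A$2$2 = 0 \<and> A$1$1 * A$1$1 - 1 = 0"
  for A :: "real^2^2"
  by (auto simp: vec_eq_iff forall_2 square_eq_1_iff)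


section \<open>Normal forms\<close>

lemma (in group) generate_left_mult_induct [consumes 2, case_names one mult]:
  assumes "h \<in> generate G S" "S \<subseteq> carrier G"
    and one: "P \<one>"
    and mult: "\<And>s k w. s \<in> S \<Longrightarrow> w \<in> carrier G \<Longrightarrow> P w \<Longrightarrow> P (s [^] (k::int) \<otimes> w)"
  shows "P h"
proof -
  \<comment> \<open>Closure of \<open>P\<close> under left multiplication by \<open>h\<close> is
    what passes through products of elements; \<open>P h\<close> alone would not.\<close>
  have "\<forall>w\<in>carrier G. P w \<longrightarrow> P (h \<otimes> w)"
    using assms(1)
  proof (induction h rule: generate.induct)
    case (incl h)
    then show ?case using mult[of h _ 1] assms(2) by auto
  next
    case (inv h)
    then have "h \<in> carrier G" using assms(2) by auto
    then show ?case using mult[of h _ "-1"] inv by (auto simp: int_pow_neg)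
  next
    case (eng g h)
    then show ?case
      using generate_in_carrier[OF assms(2)] by (auto simp: m_assoc)
  qed auto
  then show ?thesis
    using one generate_in_carrier[OF assms(2,1)] by force
qed

text \<open>The predicate \<open>ok\<close> restricts the last two exponents: elements are normalized modulo a subset
  \<open>R\<close> acting on the right, and \<open>ok\<close> excludes the words that this shortens.\<close>

inductive_set alternating ::
  "('g, 'z) monoid_scheme \<Rightarrow> 'g \<Rightarrow> 'g \<Rightarrow> (int \<Rightarrow> int \<Rightarrow> bool) \<Rightarrow> 'g set"
  for G :: "('g, 'z) monoid_scheme" and a c ok where
  base: "m \<noteq> 0 \<Longrightarrow> ok m n \<Longrightarrow> c [^]\<^bsub>G\<^esub> m \<otimes>\<^bsub>G\<^esub> a [^]\<^bsub>G\<^esub> n \<in> alternating G a c ok"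
| step: "u \<in> alternating G a c ok \<Longrightarrow> (m::int) \<noteq> 0 \<Longrightarrow> (n::int) \<noteq> 0 \<Longrightarrow>
           c [^]\<^bsub>G\<^esub> m \<otimes>\<^bsub>G\<^esub> (a [^]\<^bsub>G\<^esub> n \<otimes>\<^bsub>G\<^esub> u) \<in> alternating G a c ok"

lemma (in group) alternating_closed:
  "u \<in> alternating G a c ok \<Longrightarrow> a \<in> carrier G \<Longrightarrow> c \<in> carrier G \<Longrightarrow> u \<in> carrier G"
  by (induction rule: alternating.induct) auto

lemma (in group) int_pow_mult_assoc:
  assumes "x \<in> carrier G" "w \<in> carrier G"
  shows "x [^] (m::int) \<otimes> (x [^] (n::int) \<otimes> w) = x [^] (m + n) \<otimes> w"
  using assms by (simp add: int_pow_mult m_assoc)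

text \<open>A power of \<open>a\<close> on the left is absorbed in front. A power of
  \<open>c\<close> starts a new syllable, merges with the first one or cancels it, and a last
  syllable that \<open>ok\<close> excludes disappears into \<open>R\<close>. Only existence of the
  form is claimed; that such words are nontrivial is left to the matrices.\<close>

lemma (in group) alternating_form:
  assumes a: "a \<in> carrier G" and c: "c \<in> carrier G"
    and R: "R \<subseteq> carrier G" "\<one> \<in> R" "\<And>r s. r \<in> R \<Longrightarrow> s \<in> R \<Longrightarrow> r \<otimes> s \<in> R"
    and not_ok: "\<And>m n. m \<noteq> 0 \<Longrightarrow> \<not> ok m n \<Longrightarrow>
           \<exists>n'. \<exists>r\<in>R. c [^] m \<otimes> a [^] n = a [^] (n'::int) \<otimes> r"
    and h: "h \<in> generate G {a, c}"
  shows "\<exists>n::int. \<exists>r\<in>R. h = a [^] n \<otimes> r \<or>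
           (\<exists>u\<in>alternating G a c ok. h = a [^] n \<otimes> (u \<otimes> r))"
proof -
  have "{a, c} \<subseteq> carrier G" using a c by simp
  with h show ?thesis
  proof (induction h rule: generate_left_mult_induct)
    case one
    show ?case using R by (intro exI[of _ 0] bexI[of _ \<one>]) auto
  next
    case (mult s k w)
    let ?W = "alternating G a c ok"
    have W: "u \<in> carrier G" if "u \<in> ?W" for u using alternating_closed[OF that a c] .
    obtain n :: int and r where r: "r \<in> R"
      and w: "w = a [^] n \<otimes> r \<or> (\<exists>u\<in>?W. w = a [^] n \<otimes> (u \<otimes> r))"
      using mult by blast
    have rG: "r \<in> carrier G" using r R by auto
    define form where "form = (\<lambda>h. \<exists>n::int. \<exists>r\<in>R. h = a [^] n \<otimes> r \<or>
             (\<exists>u\<in>?W. h = a [^] n \<otimes> (u \<otimes> r)))"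
    have form1: "form (a [^] n \<otimes> r)" for n :: int using r by (auto simp: form_def)
    have form2: "form (u \<otimes> r)" if "u \<in> ?W" for u
      unfolding form_def using that r W[OF that] rG
      by (intro exI[of _ 0] bexI[of _ r] disjI2 bexI[of _ u]) auto
    \<comment> \<open>Covers every product that consists of a single syllable, including the one
      where the exponent has become 0.\<close>
    have c1: "form (c [^] k \<otimes> (a [^] n \<otimes> r))" for k n :: int
    proof (cases "k = 0")
      case True
      then show ?thesis using form1 a rG by simp
    next
      case k: False
      show ?thesis
      proof (cases "ok k n")
        case True
        then show ?thesis
          using form2[OF alternating.base[of k ok n G c a]] k a c rG by (simp add: m_assoc)
      next
        case False
        obtain n' :: int and r' where r': "r' \<in> R" "c [^] k \<otimes> a [^] n = a [^] n' \<otimes> r'"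
          using not_ok[OF k False] by blast
        have "c [^] k \<otimes> (a [^] n \<otimes> r) = (c [^] k \<otimes> a [^] n) \<otimes> r"
          using a c rG by (simp add: m_assoc)
        also have "\<dots> = a [^] n' \<otimes> (r' \<otimes> r)"
          using r' R rG a by (auto simp: m_assoc)
        finally show ?thesis unfolding form_def using R(3)[OF r'(1) r] by metis
      qed
    qed
    have "form (s [^] k \<otimes> w)"
    proof (cases "s = c")
      case False
      then have s: "s = a" using mult by simp
      show ?thesis using w
      proof
        assume "w = a [^] n \<otimes> r"
        then show ?thesis unfolding form_def s using r a rG
          by (intro exI[of _ "k + n"] bexI[of _ r]) (auto simp: int_pow_mult m_assoc)
      next
        assume "\<exists>u\<in>?W. w = a [^] n \<otimes> (u \<otimes> r)"
        then obtain u where u: "u \<in> ?W" "w = a [^] n \<otimes> (u \<otimes> r)" by blast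
        then show ?thesis unfolding form_def s using r a rG W[OF u(1)]
          by (intro exI[of _ "k + n"] bexI[of _ r] disjI2 bexI[of _ u])
            (auto simp: int_pow_mult m_assoc)
      qed
    next
      case s: True
      show ?thesis using w
      proof
        assume "w = a [^] n \<otimes> r"
        then show ?thesis using c1 s by simp
      next
        assume "\<exists>u\<in>?W. w = a [^] n \<otimes> (u \<otimes> r)"
        then obtain u where u: "u \<in> ?W" "w = a [^] n \<otimes> (u \<otimes> r)" by blast
        consider "k = 0" | "k \<noteq> 0" "n \<noteq> 0" | "k \<noteq> 0" "n = 0" by blast
        then show ?thesis
        proof cases
          case 1
          then show ?thesis using u r a c rG W[OF u(1)] unfolding form_def by auto
        next
          case 2
          then show ?thesis
            using form2[OF alternating.step[OF u(1), of k n]] u s a c rG W[OF u(1)]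
            by (simp add: m_assoc)
        next
          case 3
          \<comment> \<open>With no power of \<open>a\<close> in between, the new power of
            \<open>c\<close> merges with the leading one of \<open>u\<close>. If they cancel in a
            longer word, what remains is a power of \<open>a\<close> times a shorter alternating
            word.\<close>
          then have sw: "s [^] k \<otimes> w = c [^] k \<otimes> (u \<otimes> r)" using s u rG W[OF u(1)] by simp
          show ?thesis using u(1)
          proof cases
            case (base m p)
            then have "s [^] k \<otimes> w = c [^] (k + m) \<otimes> (a [^] p \<otimes> r)"
              using sw a c rG by (simp add: m_assoc int_pow_mult_assoc)
            then show ?thesis using c1 by simp
          next
            case (step v m p)
            have v: "v \<in> carrier G" using W step by simp
            have e: "s [^] k \<otimes> w = c [^] (k + m) \<otimes> (a [^] p \<otimes> (v \<otimes> r))"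
              using sw a c rG v step by (simp add: m_assoc int_pow_mult_assoc)
            show ?thesis
            proof (cases "k + m = 0")
              case True
              have "s [^] k \<otimes> w = a [^] p \<otimes> (v \<otimes> r)" using e a v rG by (simp add: True)
              then show ?thesis unfolding form_def using step r by blast
            next
              case False
              then show ?thesis
                using form2[OF alternating.step[OF step(2) False step(4)]] e a c v rG
                by (simp add: m_assoc)
            qed
          qed
        qed
      qed
    qed
    then show ?case by (simp add: form_def)
  qed
qed

section \<open>Britton reduction in an HNN extension\<close>

abbreviation signed :: "('g, 'z) monoid_scheme \<Rightarrow> 'g \<Rightarrow> bool \<Rightarrow> 'g" where
  "signed G y e \<equiv> (if e then y else inv\<^bsub>G\<^esub> y)"

text \<open>Words without pinches over an HNN extension with base \<open>B\<close> and stable letter \<open>y\<close>, where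
  \<open>y\<close> conjugates \<open>A\<close> to \<open>A'\<close>. The Boolean records the exponent of the first stable letter.\<close>

inductive britton ::
  "('g, 'z) monoid_scheme \<Rightarrow> 'g \<Rightarrow> 'g set \<Rightarrow> 'g set \<Rightarrow> 'g set \<Rightarrow> bool \<Rightarrow> 'g \<Rightarrow> bool"
  for G :: "('g, 'z) monoid_scheme" and y B A A' where
  base: "h \<in> B \<Longrightarrow> britton G y B A A' e (signed G y e \<otimes>\<^bsub>G\<^esub> h)"
| step: "britton G y B A A' e' u \<Longrightarrow> h \<in> B \<Longrightarrow> (e \<Longrightarrow> \<not> e' \<Longrightarrow> h \<notin> A) \<Longrightarrow>
         (\<not> e \<Longrightarrow> e' \<Longrightarrow> h \<notin> A') \<Longrightarrow> britton G y B A A' e (signed G y e \<otimes>\<^bsub>G\<^esub> (h \<otimes>\<^bsub>G\<^esub> u))"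

lemma (in group) britton_closed:
  "britton G y B A A' e u \<Longrightarrow> y \<in> carrier G \<Longrightarrow> B \<subseteq> carrier G \<Longrightarrow> u \<in> carrier G"
  by (induction rule: britton.induct) auto

text \<open>A new stable letter can form a pinch only with the first stable letter of
  \<open>w\<close>. The pinch collapses to an element \<open>g\<close> of \<open>B\<close>, and the
  rest of the word, which has no pinches already, remains as it is.\<close>

lemma (in group) britton_form:
  assumes y: "y \<in> carrier G" and B: "subgroup B G"
    and A: "A \<subseteq> B" "A' \<subseteq> B"
    and conj: "\<And>h. h \<in> A \<Longrightarrow> y \<otimes> h \<otimes> inv y \<in> B" "\<And>h. h \<in> A' \<Longrightarrow> inv y \<otimes> h \<otimes> y \<in> B"
    and w: "w \<in> B \<or> (\<exists>h\<in>B. \<exists>e u. britton G y B A A' e u \<and> w = h \<otimes> u)"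
  shows "signed G y e \<otimes> w \<in> B \<or>
    (\<exists>h\<in>B. \<exists>e' u. britton G y B A A' e' u \<and> signed G y e \<otimes> w = h \<otimes> u)"
proof -
  let ?P = "britton G y B A A'"
  have BG: "B \<subseteq> carrier G" using B by (rule subgroup.subset)
  have one: "\<one> \<in> B" using B by (rule subgroup.one_closed)
  have cl: "u \<in> carrier G" if "?P e u" for e u using britton_closed[OF that y BG] .
  have direct: "\<exists>h\<in>B. \<exists>e' u. ?P e' u \<and> v = h \<otimes> u" if "?P e v" for e v
    using that cl[OF that] one by (intro bexI[of _ \<one>] exI[of _ e] exI[of _ v]) auto
  show ?thesis using w
  proof
    assume "w \<in> B"
    then show ?thesis using direct[OF britton.base[of w B G y A A' e]] by simp
  next
    assume "\<exists>h\<in>B. \<exists>e u. ?P e u \<and> w = h \<otimes> u"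
    then obtain h e' u where h: "h \<in> B" and u: "?P e' u" and w: "w = h \<otimes> u" by blast
    have hG: "h \<in> carrier G" using h BG by auto
    show ?thesis
    proof (cases "(e \<and> \<not> e' \<and> h \<in> A) \<or> (\<not> e \<and> e' \<and> h \<in> A')")
      case False
      then have "?P e (signed G y e \<otimes> (h \<otimes> u))"
        by (intro britton.step[OF u h]) auto
      then show ?thesis using direct w by blast
    next
      case True
      define g where "g = signed G y e \<otimes> h \<otimes> signed G y e'"
      have g: "g \<in> B" using True conj by (auto simp: g_def)
      have gG: "g \<in> carrier G" using g BG by auto
      have yy: "signed G y e' \<in> carrier G" "signed G y e \<in> carrier G" using y by auto
      show ?thesis using u
      proof cases
        case (base k)
        then have "k \<in> carrier G" using BG by auto
        then have "signed G y e \<otimes> w = g \<otimes> k"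
          using hG yy by (simp only: w base g_def m_assoc m_closed)
        then show ?thesis using g base subgroup.m_closed[OF B] by simp
      next
        case (step e'' v k)
        have v: "v \<in> carrier G" "k \<in> carrier G" using cl[OF step(2)] step BG by auto
        then have "signed G y e \<otimes> w = (g \<otimes> k) \<otimes> v"
          using hG yy by (simp only: w step g_def m_assoc m_closed)
        then show ?thesis using g step subgroup.m_closed[OF B] by blast
      qed
    qed
  qed
qed


section \<open>The free group on \<open>X\<close> and \<open>Y\<close>\<close>

abbreviation gen_X :: "generator letter list set" where "gen_X \<equiv> F2_gen GX"
abbreviation gen_Y :: "generator letter list set" where "gen_Y \<equiv> F2_gen GY"

interpretation F2: group F2
  by (rule group_presented_group)

interpretation SL2R: group SL2R
  by (rule group_SL2R)

lemma F2_gen_closed [simp, intro]: "F2_gen g \<in> carrier F2"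
  by (auto simp: F2_gen_def carrier_presented_group)

lemma F2_generated: "carrier F2 = generate F2 {gen_X, gen_Y}"
proof
  let ?S = "generate F2 {gen_X, gen_Y}"
  have S: "subgroup ?S F2" by (intro F2.generate_is_subgroup) auto
  have rel: "word_equiv F2_relators [Gen GX, Gen GY, Gen GZ] []"
    using word_relator[of "[Gen GX, Gen GY, Gen GZ]" F2_relators "[]" "[]"]
    by (simp add: F2_relators_def)
  have "(gen_X \<otimes>\<^bsub>F2\<^esub> gen_Y) \<otimes>\<^bsub>F2\<^esub> F2_gen GZ = \<one>\<^bsub>F2\<^esub>"
    using rel by (simp add: F2_gen_def mult_presented_group one_presented_group word_class_eq_iff)
  then have "inv\<^bsub>F2\<^esub> F2_gen GZ = gen_X \<otimes>\<^bsub>F2\<^esub> gen_Y"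
    by (rule F2.inv_equality) simp_all
  then have Z: "F2_gen GZ = inv\<^bsub>F2\<^esub> (gen_X \<otimes>\<^bsub>F2\<^esub> gen_Y)"
    using F2.inv_inv[OF F2_gen_closed[of GZ]] by simp
  have gen: "F2_gen g \<in> ?S" for g
  proof (cases g)
    case GZ
    then show ?thesis unfolding GZ Z
      by (intro subgroup.m_inv_closed[OF S] subgroup.m_closed[OF S] generate.incl) auto
  qed (auto intro: generate.incl)
  have letter: "word_class F2_relators [l] \<in> ?S" for l
  proof (cases l)
    case (Gen g)
    then show ?thesis using gen[of g] by (simp flip: F2_gen_def)
  next
    case (Inv g)
    have "word_equiv F2_relators [Inv g, Gen g] []"
      using word_cancel[of F2_relators "[]" "Inv g" "[]"] by simp
    then have "word_class F2_relators [Inv g] = inv\<^bsub>F2\<^esub> F2_gen g"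
      by (intro F2.inv_equality[symmetric])
        (auto simp: F2_gen_def mult_presented_group one_presented_group word_class_eq_iff
          carrier_presented_group)
    then show ?thesis using Inv gen[of g] subgroup.m_inv_closed[OF S] by simp
  qed
  have "word_class F2_relators u \<in> ?S" for u
  proof (induction u)
    case Nil
    then show ?case using generate.one[of F2] by (simp add: one_presented_group)
  next
    case (Cons l u)
    then show ?case
      using subgroup.m_closed[OF S letter[of l] Cons] by (simp add: mult_presented_group)
  qed
  then show "carrier F2 \<subseteq> ?S" by (auto simp: carrier_presented_group)
qed (use F2.generate_incl in auto)

lemma F2_induct [consumes 1, case_names one X X_inv Y Y_inv]:
  assumes "w \<in> carrier F2" and "P \<one>\<^bsub>F2\<^esub>"
    and "\<And>w. w \<in> carrier F2 \<Longrightarrow> P w \<Longrightarrow> P (gen_X \<otimes>\<^bsub>F2\<^esub> w)"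
    and "\<And>w. w \<in> carrier F2 \<Longrightarrow> P w \<Longrightarrow> P (inv\<^bsub>F2\<^esub> gen_X \<otimes>\<^bsub>F2\<^esub> w)"
    and "\<And>w. w \<in> carrier F2 \<Longrightarrow> P w \<Longrightarrow> P (gen_Y \<otimes>\<^bsub>F2\<^esub> w)"
    and "\<And>w. w \<in> carrier F2 \<Longrightarrow> P w \<Longrightarrow> P (inv\<^bsub>F2\<^esub> gen_Y \<otimes>\<^bsub>F2\<^esub> w)"
  shows "P w"
proof -
  have "\<forall>v\<in>carrier F2. P v \<longrightarrow> P (w \<otimes>\<^bsub>F2\<^esub> v)"
    using assms(1) unfolding F2_generated
  proof (induction w rule: generate.induct)
    case (eng g h)
    then have "g \<in> carrier F2" "h \<in> carrier F2" by (simp_all add: F2_generated)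
    then show ?case using eng by (simp add: F2.m_assoc flip: F2_generated)
  qed (use assms(3-) in \<open>auto simp flip: F2_generated\<close>)
  then show ?thesis using assms(1,2) by force
qed

lemma countable_F2: "countable (carrier F2)"
proof -
  have "UNIV = {GX, GY, GZ}" using generator.exhaust by auto
  then have "finite (UNIV :: generator set)" by (metis finite.simps)
  moreover have "(UNIV :: generator letter set) = range Gen \<union> range Inv"
    by (metis UNIV_eq_I UnI1 UnI2 letter.exhaust rangeI)
  ultimately have "finite (UNIV :: generator letter set)" by (metis finite_Un finite_imageI)
  then have "countable (lists (UNIV :: generator letter set))"
    by (intro countable_lists) (rule countable_finite)
  then show ?thesis by (simp add: carrier_presented_group)
qed


section \<open>A rational parametrization of the representations\<close>

text \<open>Here \<open>K = 2 - tr [X, Y]\<close>. For \<open>X\<close> diagonal with eigenvalue \<open>x\<close>, this trace prescribes the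
  product \<open>del K x\<close> of the diagonal entries of \<open>Y\<close>, and the only freedom left up to conjugation is
  the twist parameter \<open>t\<close>. The off-diagonal entries are balanced so that \<open>[X, Y]\<close> does not depend
  on \<open>t\<close> and converges as \<open>x\<close> grows.\<close>

definition gam :: "real \<Rightarrow> real \<Rightarrow> real" where
  "gam K x = K * x^4 / (x\<^sup>2 - 1)\<^sup>2"

definition del :: "real \<Rightarrow> real \<Rightarrow> real" where
  "del K x = 1 + K * x\<^sup>2 / (x\<^sup>2 - 1)\<^sup>2"

definition mat_X :: "real \<Rightarrow> real^2^2" where
  "mat_X x = mat2 x 0 0 (1 / x)"

text \<open>This is \<open>mat_Y K x 1\<close> times the diagonal matrix with entries t and 1/t.
  That factor commutes with \<open>mat_X x\<close>, so it drops out of the conjugate of X by Y and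
  hence out of the whole vertex group.\<close>

definition mat_Y :: "real \<Rightarrow> real \<Rightarrow> real \<Rightarrow> real^2^2" where
  "mat_Y K x t = mat2 t (1 / (x\<^sup>2 * t)) (gam K x * t) (del K x / t)"

definition rep :: "real \<Rightarrow> real \<Rightarrow> real \<Rightarrow> generator letter list set \<Rightarrow> real^2^2" where
  "rep K x t = F2_hom SL2R (mat_X x) (mat_Y K x t)"

abbreviation base_rep :: "real \<Rightarrow> real \<Rightarrow> generator letter list set \<Rightarrow> real^2^2" where
  "base_rep K x \<equiv> rep K x 1"

text \<open>For X diagonal with entries x, 1/x and Y of determinant 1 with off-diagonal entries b,
  c, the trace of \<open>[X, Y]\<close> is 2 - bc (x - 1/x)^2. Equating it with 2 - K gives bc =
  \<open>gam K x / x^2\<close>, and the identity says that Y has determinant 1.\<close>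

lemma del_gam: "x > 1 \<Longrightarrow> del K x - gam K x / x\<^sup>2 = 1"
  by (simp add: del_def gam_def power2_eq_square power4_eq_xxxx)

lemma det_mat_X: "x > 1 \<Longrightarrow> det (mat_X x) = 1"
  by (simp add: mat_X_def)

lemma det_mat_Y: "x > 1 \<Longrightarrow> t > 0 \<Longrightarrow> det (mat_Y K x t) = 1"
  using del_gam[of x K] by (simp add: mat_Y_def)

context
  fixes K x t :: real
  assumes x: "x > 1" and t: "t > 0"
begin

lemma rep_hom: "rep K x t \<in> hom F2 SL2R"
  and rep_X: "rep K x t gen_X = mat_X x"
  and rep_Y: "rep K x t gen_Y = mat_Y K x t"
  using group.F2_hom[OF group_SL2R, of "mat_X x" "mat_Y K x t"] det_mat_X[OF x] det_mat_Y[OF x t]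
  by (simp_all add: rep_def)

lemma rep_mult:
  "v \<in> carrier F2 \<Longrightarrow> w \<in> carrier F2 \<Longrightarrow> rep K x t (v \<otimes>\<^bsub>F2\<^esub> w) = rep K x t v ** rep K x t w"
  using hom_mult[OF rep_hom] by simp

lemma det_rep: "w \<in> carrier F2 \<Longrightarrow> det (rep K x t w) = 1"
  using hom_in_carrier[OF rep_hom] by fastforce

lemma rep_one: "rep K x t \<one>\<^bsub>F2\<^esub> = mat 1"
  using hom_one[OF rep_hom group_presented_group group_SL2R] by simp

lemma rep_inv:
  assumes "w \<in> carrier F2"
  shows "rep K x t (inv\<^bsub>F2\<^esub> w) = mat2 (rep K x t w $ 2 $ 2) (- rep K x t w $ 1 $ 2)
      (- rep K x t w $ 2 $ 1) (rep K x t w $ 1 $ 1)"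
proof -
  interpret group_hom F2 SL2R "rep K x t"
    by unfold_locales (rule rep_hom)
  show ?thesis using hom_inv[OF assms] inv_SL2R[OF det_rep[OF assms]] by simp
qed

lemma rep_X_inv: "rep K x t (inv\<^bsub>F2\<^esub> gen_X) = mat2 (1 / x) 0 0 x"
  by (simp add: rep_inv rep_X) (simp add: mat_X_def)

lemma rep_Y_inv:
  "rep K x t (inv\<^bsub>F2\<^esub> gen_Y) = mat2 (del K x / t) (- 1 / (x\<^sup>2 * t)) (- gam K x * t) t"
  by (simp add: rep_inv rep_Y) (simp add: mat_Y_def)

lemma rep_X_pow: "rep K x t (gen_X [^]\<^bsub>F2\<^esub> (n::int)) = mat2 (x powi n) 0 0 (x powi (- n))"
proof (induction n rule: int_induct[of _ 0])
  case base
  then show ?case by (simp add: rep_one) (intro mat2_eqI; simp)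
next
  case (step1 i)
  have r: "rep K x t (gen_X [^]\<^bsub>F2\<^esub> (i + 1)) = rep K x t (gen_X [^]\<^bsub>F2\<^esub> i) ** mat_X x"
    by (simp add: F2.int_pow_mult rep_mult rep_X)
  have p: "x powi (i + 1) = x powi i * x" "x powi (- (i + 1)) = x powi (- i) * (1 / x)"
    using x by (simp_all add: power_int_add power_int_diff)
  show ?case unfolding r step1(2) p mat_X_def
    by (intro mat2_eqI) (simp_all add: matrix_mult_nth2)
next
  case (step2 i)
  have r: "rep K x t (gen_X [^]\<^bsub>F2\<^esub> (i - 1)) =
      rep K x t (gen_X [^]\<^bsub>F2\<^esub> i) ** rep K x t (inv\<^bsub>F2\<^esub> gen_X)"
    by (simp add: F2.int_pow_diff rep_mult)
  have p: "x powi (i - 1) = x powi i * (1 / x)" "x powi (- (i - 1)) = x powi (- i) * x"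
    using x power_int_add[of x "- i" 1] by (simp_all add: power_int_diff)
  show ?case unfolding r step2(2) p rep_X_inv
    by (intro mat2_eqI) (simp_all add: matrix_mult_nth2)
qed

end


section \<open>Degeneration as the length of \<open>X\<close> grows\<close>

text \<open>Projective convergence to a point off both coordinate axes. The common factor
  \<open>x powi N\<close> is needed because the vectors may grow or shrink like a power of
  x.\<close>

definition generic_limit :: "(real \<Rightarrow> real^2) \<Rightarrow> bool" where
  "generic_limit f \<longleftrightarrow> (\<exists>N::int. \<exists>a b. a \<noteq> 0 \<and> b \<noteq> 0 \<and>
     ((\<lambda>x. x powi N * f x $ 1) \<longlongrightarrow> a) at_top \<and> ((\<lambda>x. x powi N * f x $ 2) \<longlongrightarrow> b) at_top)"

lemma generic_limit_cong:
  assumes "eventually (\<lambda>x. f x = g x) at_top" "generic_limit f"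
  shows "generic_limit g"
proof -
  obtain N :: int and a b where N: "a \<noteq> 0" "b \<noteq> 0"
    "((\<lambda>x. x powi N * f x $ 1) \<longlongrightarrow> a) at_top" "((\<lambda>x. x powi N * f x $ 2) \<longlongrightarrow> b) at_top"
    using assms(2) unfolding generic_limit_def by blast
  have "eventually (\<lambda>x. x powi N * f x $ i = x powi N * g x $ i) at_top" for i
    using assms(1) by eventually_elim simp
  from Lim_transform_eventually[OF N(3) this] Lim_transform_eventually[OF N(4) this]
  show ?thesis using N(1,2) unfolding generic_limit_def by blast
qed

lemma generic_limit_nonzero:
  assumes "generic_limit f"
  shows "eventually (\<lambda>x. f x $ 1 \<noteq> 0 \<and> f x $ 2 \<noteq> 0) at_top"
proof -
  obtain N :: int and a b where N: "a \<noteq> 0" "b \<noteq> 0"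
    "((\<lambda>x. x powi N * f x $ 1) \<longlongrightarrow> a) at_top" "((\<lambda>x. x powi N * f x $ 2) \<longlongrightarrow> b) at_top"
    using assms unfolding generic_limit_def by blast
  from tendsto_imp_eventually_ne[OF N(3,1)] tendsto_imp_eventually_ne[OF N(4,2)]
  show ?thesis by eventually_elim auto
qed

text \<open>The diagonal matrix pushes a generic vector towards the axis that the sign of
  \<open>n\<close> favours. The limit of \<open>M\<close> then moves this axis to a generic line, as
  none of its entries is zero.\<close>

lemma generic_limit_step:
  assumes f: "generic_limit f" and n: "n \<noteq> 0"
    and M: "\<And>i j. ((\<lambda>x. M x $ i $ j) \<longlongrightarrow> E $ i $ j) at_top" and E: "\<And>i j. E $ i $ j \<noteq> 0"
  shows "generic_limit (\<lambda>x. M x *v (mat2 (x powi n) 0 0 (x powi (- n)) *v f x))"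
proof -
  obtain N :: int and a b where N: "a \<noteq> 0" "b \<noteq> 0"
    "((\<lambda>x. x powi N * f x $ 1) \<longlongrightarrow> a) at_top" "((\<lambda>x. x powi N * f x $ 2) \<longlongrightarrow> b) at_top"
    using f unfolding generic_limit_def by blast
  have small: "((\<lambda>x::real. x powi (- 2 * \<bar>n\<bar>)) \<longlongrightarrow> 0) at_top"
  proof -
    have "nat (2 * \<bar>n\<bar>) > 0" using n by simp
    then have "((\<lambda>x::real. inverse (x ^ nat (2 * \<bar>n\<bar>))) \<longlongrightarrow> 0) at_top"
      by (intro tendsto_inverse_0_at_top filterlim_pow_at_top filterlim_ident)
    moreover have "x powi (- 2 * \<bar>n\<bar>) = inverse (x ^ nat (2 * \<bar>n\<bar>))" for x :: real
    proof -
      have "- 2 * \<bar>n\<bar> = - int (nat (2 * \<bar>n\<bar>))" by simp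
      then show ?thesis by (simp only: power_int_minus power_int_of_nat)
    qed
    ultimately show ?thesis by simp
  qed
  \<comment> \<open>This exponent normalizes the dominant coordinate; the other one retains the
    factor \<open>x powi (- 2 * \<bar>n\<bar>)\<close>, which tends to 0.\<close>
  define L where "L = N - \<bar>n\<bar>"
  define g where "g = (\<lambda>x. mat2 (x powi n) 0 0 (x powi (- n)) *v f x)"
  have "\<exists>p q. ((\<lambda>x. x powi L * g x $ 1) \<longlongrightarrow> p) at_top \<and> ((\<lambda>x. x powi L * g x $ 2) \<longlongrightarrow> q) at_top
      \<and> ((p = 0 \<and> q \<noteq> 0) \<or> (p \<noteq> 0 \<and> q = 0))"
  proof (cases "n > 0")
    case True
    have 1: "eventually (\<lambda>x. x powi N * f x $ 1 = x powi L * g x $ 1) at_top"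
      using eventually_gt_at_top[of 0]
    proof eventually_elim
      case (elim x)
      have "x powi N = x powi L * x powi (n)"
        using elim True by (simp add: L_def flip: power_int_add)
      then show ?case by (simp add: g_def matrix_vector_mult_nth2)
    qed
    have 2: "eventually (\<lambda>x. x powi (- 2 * \<bar>n\<bar>) * (x powi N * f x $ 2) = x powi L * g x $ 2) at_top"
      using eventually_gt_at_top[of 0]
    proof eventually_elim
      case (elim x)
      have "x powi (- 2 * \<bar>n\<bar>) * x powi N = x powi L * x powi (- n)"
        using elim True by (simp add: L_def flip: power_int_add)
      then show ?case by (simp add: g_def matrix_vector_mult_nth2)
    qed
    show ?thesis
      using Lim_transform_eventually[OF N(3) 1]
        Lim_transform_eventually[OF tendsto_mult[OF small N(4)] 2] N(1) by auto
  next
    case False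
    have 1: "eventually (\<lambda>x. x powi N * f x $ 2 = x powi L * g x $ 2) at_top"
      using eventually_gt_at_top[of 0]
    proof eventually_elim
      case (elim x)
      have "x powi N = x powi L * x powi (- n)"
        using elim False by (simp add: L_def flip: power_int_add)
      then show ?case by (simp add: g_def matrix_vector_mult_nth2)
    qed
    have 2: "eventually (\<lambda>x. x powi (- 2 * \<bar>n\<bar>) * (x powi N * f x $ 1) = x powi L * g x $ 1) at_top"
      using eventually_gt_at_top[of 0]
    proof eventually_elim
      case (elim x)
      have "x powi (- 2 * \<bar>n\<bar>) * x powi N = x powi L * x powi n"
        using elim False by (simp add: L_def flip: power_int_add)
      then show ?case by (simp add: g_def matrix_vector_mult_nth2)
    qed
    show ?thesis
      using Lim_transform_eventually[OF N(4) 1]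
        Lim_transform_eventually[OF tendsto_mult[OF small N(3)] 2] N(2) by auto
  qed
  then obtain p q where pq: "((\<lambda>x. x powi L * g x $ 1) \<longlongrightarrow> p) at_top"
    "((\<lambda>x. x powi L * g x $ 2) \<longlongrightarrow> q) at_top" "(p = 0 \<and> q \<noteq> 0) \<or> (p \<noteq> 0 \<and> q = 0)" by blast
  have lim: "((\<lambda>x. x powi L * (M x *v g x) $ i) \<longlongrightarrow> E $ i $ 1 * p + E $ i $ 2 * q) at_top" for i
    using tendsto_add[OF tendsto_mult[OF M[of i 1] pq(1)] tendsto_mult[OF M[of i 2] pq(2)]]
    by (simp add: matrix_vector_mult_nth2 algebra_simps)
  have "E $ i $ 1 * p + E $ i $ 2 * q \<noteq> 0" for i using pq(3) E by auto
  then show ?thesis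
    using lim[of 1] lim[of 2] unfolding generic_limit_def g_def by blast
qed

text \<open>The word acts from its right end. In the last syllable \<open>n\<close> may be 0, and
  \<open>base\<close> has to deal with the vector \<open>v x\<close>; every syllable to its left has
  two nonzero exponents, as \<open>generic_limit_step\<close> requires.\<close>

lemma alternating_generic:
  assumes c: "c \<in> carrier F2"
    and M: "\<And>m i j. ((\<lambda>x. base_rep K x (c [^]\<^bsub>F2\<^esub> (m::int)) $ i $ j) \<longlongrightarrow> E m $ i $ j) at_top"
    and E: "\<And>m i j. m \<noteq> 0 \<Longrightarrow> E m $ i $ j \<noteq> 0"
    and base: "\<And>m n. m \<noteq> 0 \<Longrightarrow> ok m n \<Longrightarrow>
      generic_limit (\<lambda>x. base_rep K x (c [^]\<^bsub>F2\<^esub> m \<otimes>\<^bsub>F2\<^esub> gen_X [^]\<^bsub>F2\<^esub> n) *v v x)"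
    and u: "u \<in> alternating F2 gen_X c ok"
  shows "generic_limit (\<lambda>x. base_rep K x u *v v x)"
  using u
proof (induction rule: alternating.induct)
  case (step u m n)
  have uF: "u \<in> carrier F2" using F2.alternating_closed[OF step(1)] c by auto
  have "eventually (\<lambda>x::real. x > 1) at_top" by (rule eventually_gt_at_top)
  then have "eventually (\<lambda>x. base_rep K x (c [^]\<^bsub>F2\<^esub> m) *v
      (mat2 (x powi n) 0 0 (x powi (- n)) *v (base_rep K x u *v v x)) =
      base_rep K x (c [^]\<^bsub>F2\<^esub> m \<otimes>\<^bsub>F2\<^esub> (gen_X [^]\<^bsub>F2\<^esub> n \<otimes>\<^bsub>F2\<^esub> u)) *v v x) at_top"
    by eventually_elim
      (simp add: uF c rep_mult rep_X_pow matrix_vector_mul_assoc matrix_mul_assoc)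
  then show ?case
    by (rule generic_limit_cong[OF _ generic_limit_step[OF step(4,3) M E[OF step(2)]]])
qed (rule base)

lemma matrix_vector_mult_axis2 [simp]: "(A *v axis j 1) $ i = A $ i $ j"
  for A :: "real^2^2"
  using exhaust_2[of j] by (auto simp: matrix_vector_mult_nth2 axis_def)

text \<open>Powers of X on the left are diagonal and do not decide which entries vanish, so an
  alternating word remains. Its columns are its values at the basis vectors. These are not generic,
  but a final power of X only rescales them, and a nontrivial power of \<open>c\<close> then makes
  them generic.\<close>

lemma off_diagonal_nonzero:
  assumes c: "c \<in> carrier F2"
    and M: "\<And>m i j. ((\<lambda>x. base_rep K x (c [^]\<^bsub>F2\<^esub> (m::int)) $ i $ j) \<longlongrightarrow> E m $ i $ j) at_top"
    and E: "\<And>m i j. m \<noteq> 0 \<Longrightarrow> E m $ i $ j \<noteq> 0"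
    and h: "h \<in> generate F2 {gen_X, c}" "h \<notin> range (\<lambda>n::int. gen_X [^]\<^bsub>F2\<^esub> n)"
  shows "eventually (\<lambda>x. base_rep K x h $ 1 $ 2 \<noteq> 0 \<and> base_rep K x h $ 2 $ 1 \<noteq> 0) at_top"
proof -
  let ?A = "alternating F2 gen_X c (\<lambda>_ _. True)"
  have "\<exists>n::int. \<exists>r\<in>{\<one>\<^bsub>F2\<^esub>}. h = gen_X [^]\<^bsub>F2\<^esub> n \<otimes>\<^bsub>F2\<^esub> r \<or>
      (\<exists>u\<in>?A. h = gen_X [^]\<^bsub>F2\<^esub> n \<otimes>\<^bsub>F2\<^esub> (u \<otimes>\<^bsub>F2\<^esub> r))"
    by (rule F2.alternating_form[OF F2_gen_closed c _ _ _ _ h(1)]) simp_all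
  then obtain n :: int where "h = gen_X [^]\<^bsub>F2\<^esub> n \<otimes>\<^bsub>F2\<^esub> \<one>\<^bsub>F2\<^esub> \<or>
      (\<exists>u\<in>?A. h = gen_X [^]\<^bsub>F2\<^esub> n \<otimes>\<^bsub>F2\<^esub> (u \<otimes>\<^bsub>F2\<^esub> \<one>\<^bsub>F2\<^esub>))" by blast
  moreover have "h \<noteq> gen_X [^]\<^bsub>F2\<^esub> n \<otimes>\<^bsub>F2\<^esub> \<one>\<^bsub>F2\<^esub>" using h(2) by auto
  ultimately obtain u where u: "u \<in> ?A"
    and hu: "h = gen_X [^]\<^bsub>F2\<^esub> n \<otimes>\<^bsub>F2\<^esub> u"
    using F2.alternating_closed[OF _ F2_gen_closed c] by auto
  have uF: "u \<in> carrier F2" using F2.alternating_closed[OF u] c by auto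
  have gt: "eventually (\<lambda>x::real. x > 1) at_top" by (rule eventually_gt_at_top)
  have good: "generic_limit (\<lambda>x. base_rep K x u *v axis j 1)" for j
  proof (rule alternating_generic[OF c M E _ u])
    fix m p :: int assume m: "m \<noteq> 0"
    \<comment> \<open>Undoes the factor by which \<open>gen_X [^] p\<close> scales the basis vector
      \<open>axis j 1\<close>.\<close>
    define N where "N = (if j = 1 then - p else p)"
    have eq: "eventually (\<lambda>x. base_rep K x (c [^]\<^bsub>F2\<^esub> m) $ i $ j = x powi N *
        (base_rep K x (c [^]\<^bsub>F2\<^esub> m \<otimes>\<^bsub>F2\<^esub> gen_X [^]\<^bsub>F2\<^esub> p) *v axis j 1) $ i) at_top" for i
      using gt
    proof eventually_elim
      case (elim x)
      have "x powi (- p) * x powi p = 1" "x powi p * x powi (- p) = 1"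
        using elim by (simp_all flip: power_int_add)
      moreover have "base_rep K x (c [^]\<^bsub>F2\<^esub> m \<otimes>\<^bsub>F2\<^esub> gen_X [^]\<^bsub>F2\<^esub> p) $ i $ j =
          base_rep K x (c [^]\<^bsub>F2\<^esub> m) $ i $ j * x powi (- N)"
        using exhaust_2[of j] elim c
        by (auto simp: N_def rep_mult rep_X_pow matrix_mult_nth2)
      ultimately show ?case by (simp add: N_def split: if_splits)
    qed
    show "generic_limit (\<lambda>x. base_rep K x (c [^]\<^bsub>F2\<^esub> m \<otimes>\<^bsub>F2\<^esub> gen_X [^]\<^bsub>F2\<^esub> p) *v axis j 1)"
      unfolding generic_limit_def
      using Lim_transform_eventually[OF M eq[of 1]] Lim_transform_eventually[OF M eq[of 2]] E[OF m]
      by blast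
  qed
  from gt generic_limit_nonzero[OF good[of 1]] generic_limit_nonzero[OF good[of 2]] show ?thesis
    by eventually_elim (simp add: uF hu rep_mult rep_X_pow matrix_mult_nth2)
qed

section \<open>The commutator and the limits of its powers\<close>

lemma tendsto_gam: "(gam K \<longlongrightarrow> K) at_top"
  unfolding gam_def[abs_def] by real_asymp

lemma tendsto_del: "(del K \<longlongrightarrow> 1) at_top"
  unfolding del_def[abs_def] by real_asymp

lemma tendsto_inverse_powers:
  "((\<lambda>x::real. 1 / x\<^sup>2) \<longlongrightarrow> 0) at_top" "((\<lambda>x::real. 1 / x^4) \<longlongrightarrow> 0) at_top"
  by real_asymp+

text \<open>\<open>comm'\<close> is the conjugate of \<open>comm\<close> by \<open>Y\<close>; it plays the same role for the conjugate
  vertex group, so that one lemma handles both kinds of pinches.\<close>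

definition comm :: "generator letter list set" where
  "comm = gen_X \<otimes>\<^bsub>F2\<^esub> (gen_Y \<otimes>\<^bsub>F2\<^esub> (inv\<^bsub>F2\<^esub> gen_X \<otimes>\<^bsub>F2\<^esub> inv\<^bsub>F2\<^esub> gen_Y))"

definition comm' :: "generator letter list set" where
  "comm' = inv\<^bsub>F2\<^esub> gen_Y \<otimes>\<^bsub>F2\<^esub> (gen_X \<otimes>\<^bsub>F2\<^esub> (gen_Y \<otimes>\<^bsub>F2\<^esub> inv\<^bsub>F2\<^esub> gen_X))"

lemma comm_closed [simp]: "comm \<in> carrier F2" "comm' \<in> carrier F2"
  by (simp_all add: comm_def comm'_def)

lemma rep_comm:
  assumes x: "x > 1" and t: "t > 0"
  shows "rep K x t comm = mat2 (del K x - gam K x) (1 - 1 / x\<^sup>2)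
    (gam K x * del K x / x\<^sup>2 - gam K x * del K x) (del K x - gam K x / x^4)"
proof -
  have 1: "mat_X x ** mat_Y K x t = mat2 (x * t) (1 / (x * t)) (gam K x * t / x) (del K x / (x * t))"
    using x t by (intro mat2_eqI) (simp_all add: matrix_mult_nth2 mat_X_def mat_Y_def power2_eq_square)
  have 2: "mat2 (1 / x) 0 0 x ** mat2 (del K x / t) (- 1 / (x\<^sup>2 * t)) (- gam K x * t) t =
      mat2 (del K x / (x * t)) (- 1 / (x^3 * t)) (- gam K x * (x * t)) (x * t)"
    using x t by (intro mat2_eqI)
      (simp_all add: matrix_mult_nth2 power2_eq_square power3_eq_cube)
  have "rep K x t comm = (mat_X x ** mat_Y K x t) **
      (mat2 (1 / x) 0 0 x ** mat2 (del K x / t) (- 1 / (x\<^sup>2 * t)) (- gam K x * t) t)"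
    using x t by (simp add: comm_def rep_mult rep_X rep_Y rep_X_inv rep_Y_inv matrix_mul_assoc)
  also have "\<dots> = mat2 (del K x - gam K x) (1 - 1 / x\<^sup>2)
      (gam K x * del K x / x\<^sup>2 - gam K x * del K x) (del K x - gam K x / x^4)"
    unfolding 1 2 using x t by (intro mat2_eqI)
      (simp_all add: matrix_mult_nth2 power2_eq_square power3_eq_cube power4_eq_xxxx)
  finally show ?thesis .
qed

lemma rep_comm':
  assumes x: "x > 1"
  shows "base_rep K x comm' = mat2 (del K x - gam K x / x^4) (del K x - del K x / x\<^sup>2)
    (gam K x / x\<^sup>2 - gam K x) (del K x - gam K x)"
proof -
  have 1: "mat2 (del K x) (- 1 / x\<^sup>2) (- gam K x) 1 ** mat_X x =
      mat2 (del K x * x) (- 1 / x^3) (- gam K x * x) (1 / x)"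
    using x by (intro mat2_eqI) (simp_all add: matrix_mult_nth2 mat_X_def power2_eq_square power3_eq_cube)
  have 2: "mat_Y K x 1 ** mat2 (1 / x) 0 0 x = mat2 (1 / x) (1 / x) (gam K x / x) (del K x * x)"
    using x by (intro mat2_eqI) (simp_all add: matrix_mult_nth2 mat_Y_def power2_eq_square)
  have "base_rep K x comm' =
      (mat2 (del K x) (- 1 / x\<^sup>2) (- gam K x) 1 ** mat_X x) **
      (mat_Y K x 1 ** mat2 (1 / x) 0 0 x)"
    using x by (simp add: comm'_def rep_mult rep_X rep_Y rep_X_inv rep_Y_inv matrix_mul_assoc)
  also have "\<dots> = mat2 (del K x - gam K x / x^4) (del K x - del K x / x\<^sup>2)
      (gam K x / x\<^sup>2 - gam K x) (del K x - gam K x)"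
    unfolding 1 2 using x by (intro mat2_eqI)
      (simp_all add: matrix_mult_nth2 power2_eq_square power3_eq_cube power4_eq_xxxx)
  finally show ?thesis .
qed

text \<open>\<open>E m\<close> plays the role of the m-th power of the limit \<open>E 1\<close>,
  described by its recursions in both directions. The matrix in the last assumption is the adjugate,
  the limit of the inverses given by \<open>rep_inv\<close>.\<close>

lemma tendsto_pow:
  assumes c: "c \<in> carrier F2"
    and M: "\<And>i j. ((\<lambda>x. base_rep K x c $ i $ j) \<longlongrightarrow> E 1 $ i $ j) at_top"
    and E: "E 0 = mat 1" "\<And>m. E (m + 1) = E 1 ** E m"
      "\<And>m. E (m - 1) = mat2 (E 1 $ 2 $ 2) (- E 1 $ 1 $ 2) (- E 1 $ 2 $ 1) (E 1 $ 1 $ 1) ** E m"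
  shows "((\<lambda>x. base_rep K x (c [^]\<^bsub>F2\<^esub> (m::int)) $ i $ j) \<longlongrightarrow> E m $ i $ j) at_top"
proof -
  have gt: "eventually (\<lambda>x::real. x > 1) at_top" by (rule eventually_gt_at_top)
  show ?thesis
  proof (induction m arbitrary: i j rule: int_induct[of _ 0])
    case base
    have "eventually (\<lambda>x. E 0 $ i $ j = base_rep K x (c [^]\<^bsub>F2\<^esub> (0::int)) $ i $ j) at_top"
      using gt by eventually_elim (simp add: rep_one E)
    then show ?case by (rule Lim_transform_eventually[OF tendsto_const])
  next
    case (step1 m)
    have "eventually (\<lambda>x. base_rep K x c $ i $ 1 * base_rep K x (c [^]\<^bsub>F2\<^esub> m) $ 1 $ j +
        base_rep K x c $ i $ 2 * base_rep K x (c [^]\<^bsub>F2\<^esub> m) $ 2 $ j =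
        base_rep K x (c [^]\<^bsub>F2\<^esub> (m + 1)) $ i $ j) at_top"
      using gt
    proof eventually_elim
      case (elim x)
      have "c [^]\<^bsub>F2\<^esub> (m + 1) = c \<otimes>\<^bsub>F2\<^esub> c [^]\<^bsub>F2\<^esub> m"
        using c F2.int_pow_mult[of c 1 m] by (simp add: add.commute)
      then show ?case using c elim by (simp add: rep_mult matrix_mult_nth2)
    qed
    from Lim_transform_eventually[OF tendsto_add[OF tendsto_mult[OF M step1(2)]
          tendsto_mult[OF M step1(2)]] this]
    show ?case by (simp add: E(2) matrix_mult_nth2)
  next
    case (step2 m)
    define F where "F = mat2 (E 1 $ 2 $ 2) (- E 1 $ 1 $ 2) (- E 1 $ 2 $ 1) (E 1 $ 1 $ 1)"
    define d where "d = (\<lambda>x. base_rep K x (inv\<^bsub>F2\<^esub> c))"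
    have d: "((\<lambda>x. d x $ i $ j) \<longlongrightarrow> F $ i $ j) at_top" for i j
    proof -
      let ?D = "\<lambda>x. mat2 (base_rep K x c $ 2 $ 2) (- base_rep K x c $ 1 $ 2)
          (- base_rep K x c $ 2 $ 1) (base_rep K x c $ 1 $ 1)"
      have "((\<lambda>x. ?D x $ 1 $ 1) \<longlongrightarrow> F $ 1 $ 1) at_top" "((\<lambda>x. ?D x $ 1 $ 2) \<longlongrightarrow> F $ 1 $ 2) at_top"
        "((\<lambda>x. ?D x $ 2 $ 1) \<longlongrightarrow> F $ 2 $ 1) at_top" "((\<lambda>x. ?D x $ 2 $ 2) \<longlongrightarrow> F $ 2 $ 2) at_top"
        unfolding F_def mat2_nth by (intro tendsto_minus M)+
      then have "((\<lambda>x. ?D x $ i $ j) \<longlongrightarrow> F $ i $ j) at_top"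
        using exhaust_2[of i] exhaust_2[of j] by (elim disjE; simp only:)
      moreover have "eventually (\<lambda>x. ?D x $ i $ j = d x $ i $ j) at_top"
        using gt by eventually_elim (simp add: c d_def rep_inv)
      ultimately show ?thesis by (rule Lim_transform_eventually)
    qed
    have "eventually (\<lambda>x. d x $ i $ 1 * base_rep K x (c [^]\<^bsub>F2\<^esub> m) $ 1 $ j +
        d x $ i $ 2 * base_rep K x (c [^]\<^bsub>F2\<^esub> m) $ 2 $ j =
        base_rep K x (c [^]\<^bsub>F2\<^esub> (m - 1)) $ i $ j) at_top"
      using gt
    proof eventually_elim
      case (elim x)
      have "c [^]\<^bsub>F2\<^esub> (m - 1) = inv\<^bsub>F2\<^esub> c \<otimes>\<^bsub>F2\<^esub> c [^]\<^bsub>F2\<^esub> m"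
        using c F2.int_pow_mult[of c "-1" m] F2.int_pow_neg[of c 1] by (simp add: add.commute)
      then show ?case using c elim by (simp add: rep_mult matrix_mult_nth2 d_def)
    qed
    from Lim_transform_eventually[OF tendsto_add[OF tendsto_mult[OF d step2(2)]
          tendsto_mult[OF d step2(2)]] this]
    show ?case by (simp add: E(3) matrix_mult_nth2 F_def)
  qed
qed

locale irrational_angle =
  fixes \<phi> K :: real
  assumes irrational: "\<phi> / pi \<notin> \<rat>" and K_eq: "K = 2 - 2 * cos \<phi>"
begin

lemma phi_neq:
  assumes "(m::int) \<noteq> 0"
  shows "of_int m * \<phi> \<noteq> of_int k * pi"
proof
  assume "of_int m * \<phi> = of_int k * pi"
  then have "\<phi> / pi = of_int k / of_int m" using assms by (simp add: field_simps)
  then show False using irrational by simp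
qed

lemma sin_nonzero: "(m::int) \<noteq> 0 \<Longrightarrow> sin (of_int m * \<phi>) \<noteq> 0"
  using phi_neq[of m] by (auto simp: sin_zero_iff_int2)

text \<open>The diagonal entries of the limit powers are differences of consecutive values of sin(m
  phi), up to a factor. Written as a product, such a difference vanishes only if an odd multiple of
  phi is a multiple of pi.\<close>

lemma sin_neq: "sin (of_int (m + 1) * \<phi>) \<noteq> sin (of_int m * \<phi>)"
proof
  assume "sin (of_int (m + 1) * \<phi>) = sin (of_int m * \<phi>)"
  then have "sin (\<phi> / 2) * cos (of_int (2 * m + 1) * \<phi> / 2) = 0"
    using sin_diff_sin[of "of_int (m + 1) * \<phi>" "of_int m * \<phi>"] by (simp add: algebra_simps)
  then consider "sin (\<phi> / 2) = 0" | "cos (of_int (2 * m + 1) * \<phi> / 2) = 0" by auto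
  then show False
  proof cases
    case 1
    then obtain i :: int where "\<phi> / 2 = of_int i * pi" by (auto simp: sin_zero_iff_int2)
    then show False using phi_neq[of 1 "2 * i"] by simp
  next
    case 2
    then obtain i :: int where "of_int (2 * m + 1) * \<phi> / 2 = of_int i * (pi / 2)"
      by (auto simp: cos_zero_iff_int)
    then have "of_int (2 * m + 1) * \<phi> = of_int i * pi" by simp
    moreover have "2 * m + 1 \<noteq> 0" by presburger
    ultimately show False using phi_neq by blast
  qed
qed

lemma K_nonzero: "K \<noteq> 0"
proof
  assume "K = 0"
  then have "cos \<phi> = 1" by (simp add: K_eq)
  then show False using sin_nonzero[of 1] sin_cos_squared_add[of \<phi>] by simp
qed

definition S :: "int \<Rightarrow> real" where "S m = sin (of_int m * \<phi>) / sin \<phi>"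

lemma cos_phi: "2 * cos \<phi> = 2 - K"
  by (simp add: K_eq)

lemma S_simps: "S 0 = 0" "S 1 = 1" "S (m + 1) = (2 - K) * S m - S (m - 1)"
proof -
  show "S 0 = 0" "S 1 = 1" using sin_nonzero[of 1] by (simp_all add: S_def)
  have "sin (of_int (m + 1) * \<phi>) + sin (of_int (m - 1) * \<phi>) = 2 * cos \<phi> * sin (of_int m * \<phi>)"
    by (simp add: algebra_simps sin_add sin_diff)
  then have "sin (of_int (m + 1) * \<phi>) = (2 - K) * sin (of_int m * \<phi>) - sin (of_int (m - 1) * \<phi>)"
    unfolding cos_phi by linarith
  then show "S (m + 1) = (2 - K) * S m - S (m - 1)"
    unfolding S_def by (simp only: diff_divide_distrib times_divide_eq_right)
qed

lemma S_nonzero: "m \<noteq> 0 \<Longrightarrow> S m \<noteq> 0"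
  using sin_nonzero[of m] sin_nonzero[of 1] by (simp add: S_def)

lemma S_neq: "S (m + 1) \<noteq> S m" "S m \<noteq> S (m - 1)"
  using sin_neq[of m] sin_neq[of "m - 1"] sin_nonzero[of 1] by (simp_all add: S_def)

text \<open>\<open>E m\<close> and \<open>E' m\<close> are the powers of the limits of \<open>comm\<close> and \<open>comm'\<close>, elliptic elements of
  trace \<open>2 cos \<phi>\<close>; \<open>S\<close> is a Chebyshev polynomial of the second kind.\<close>

definition E :: "int \<Rightarrow> real^2^2" where
  "E m = mat2 (S (m + 1) - S m) (S m) (- K * S m) (S m - S (m - 1))"

definition E' :: "int \<Rightarrow> real^2^2" where
  "E' m = mat2 (S m - S (m - 1)) (S m) (- K * S m) (S (m + 1) - S m)"

lemma E_nonzero: "m \<noteq> 0 \<Longrightarrow> E m $ i $ j \<noteq> 0" "m \<noteq> 0 \<Longrightarrow> E' m $ i $ j \<noteq> 0"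
  using exhaust_2[of i] exhaust_2[of j] S_nonzero[of m] S_neq[of m] K_nonzero
  by (auto simp: E_def E'_def)

lemma S_2: "S 2 = 2 - K" and S_m1: "S (- 1) = - 1"
  using S_simps(3)[of 1] S_simps(3)[of 0] by (simp_all add: S_simps)

text \<open>With everything expressed by \<open>S m\<close> and \<open>S (m + 1)\<close>, the
  recursions for \<open>E\<close> and \<open>E'\<close> become polynomial identities.\<close>

lemma S_shift:
  "S (m + 2) = (2 - K) * S (m + 1) - S m"
  "S (m - 2) = (2 - K) * ((2 - K) * S m - S (m + 1)) - S m"
  "S (m - 1) = (2 - K) * S m - S (m + 1)"
  using S_simps(3)[of "m + 1"] S_simps(3)[of "m - 1"] S_simps(3)[of m]
  by (simp_all add: add.commute)

lemma E_1: "E 1 = mat2 (1 - K) 1 (- K) 1"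
  by (simp add: E_def S_simps S_2)

lemma E_rec:
  "E 0 = mat 1" "E (m + 1) = E 1 ** E m"
  "E (m - 1) = mat2 (E 1 $ 2 $ 2) (- E 1 $ 1 $ 2) (- E 1 $ 2 $ 1) (E 1 $ 1 $ 1) ** E m"
proof -
  have idx: "m + 1 + 1 = m + 2" "m + 1 - 1 = m" "m - 1 + 1 = m" "m - 1 - 1 = m - 2" by simp_all
  note d = E_def matrix_mult_nth2 mat2_nth idx S_shift[of m]
  show "E 0 = mat 1" by (intro mat2_eqI) (simp_all add: E_def S_simps S_m1)
  show "E (m + 1) = E 1 ** E m" unfolding E_1
    by (intro mat2_eqI; simp only: d; simp add: algebra_simps)
  show "E (m - 1) = mat2 (E 1 $ 2 $ 2) (- E 1 $ 1 $ 2) (- E 1 $ 2 $ 1) (E 1 $ 1 $ 1) ** E m"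
    unfolding E_1 by (intro mat2_eqI; simp only: d; simp add: algebra_simps)
qed

lemma E'_1: "E' 1 = mat2 1 1 (- K) (1 - K)"
  by (simp add: E'_def S_simps S_2)

lemma E'_rec:
  "E' 0 = mat 1" "E' (m + 1) = E' 1 ** E' m"
  "E' (m - 1) = mat2 (E' 1 $ 2 $ 2) (- E' 1 $ 1 $ 2) (- E' 1 $ 2 $ 1) (E' 1 $ 1 $ 1) ** E' m"
proof -
  have idx: "m + 1 + 1 = m + 2" "m + 1 - 1 = m" "m - 1 + 1 = m" "m - 1 - 1 = m - 2" by simp_all
  note d = E'_def matrix_mult_nth2 mat2_nth idx S_shift[of m]
  show "E' 0 = mat 1" by (intro mat2_eqI) (simp_all add: E'_def S_simps S_m1)
  show "E' (m + 1) = E' 1 ** E' m" unfolding E'_1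
    by (intro mat2_eqI; simp only: d; simp add: algebra_simps)
  show "E' (m - 1) = mat2 (E' 1 $ 2 $ 2) (- E' 1 $ 1 $ 2) (- E' 1 $ 2 $ 1) (E' 1 $ 1 $ 1) ** E' m"
    unfolding E'_1 by (intro mat2_eqI; simp only: d; simp add: algebra_simps)
qed

lemma comm_pow_limit:
  "((\<lambda>x. base_rep K x (comm [^]\<^bsub>F2\<^esub> (m::int)) $ i $ j) \<longlongrightarrow> E m $ i $ j) at_top"
proof (rule tendsto_pow[where E = E, OF comm_closed(1) _ E_rec])
  fix i j :: 2
  let ?M = "\<lambda>x. mat2 (del K x - gam K x) (1 - 1 / x\<^sup>2)
    (gam K x * del K x * (1 / x\<^sup>2) - gam K x * del K x) (del K x - gam K x * (1 / x^4))"
  let ?E = "mat2 (1 - K) (1 - 0) (K * 1 * 0 - K * 1) (1 - K * 0)"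
  have "((\<lambda>x. ?M x $ 1 $ 1) \<longlongrightarrow> ?E $ 1 $ 1) at_top" "((\<lambda>x. ?M x $ 1 $ 2) \<longlongrightarrow> ?E $ 1 $ 2) at_top"
    "((\<lambda>x. ?M x $ 2 $ 1) \<longlongrightarrow> ?E $ 2 $ 1) at_top" "((\<lambda>x. ?M x $ 2 $ 2) \<longlongrightarrow> ?E $ 2 $ 2) at_top"
    unfolding mat2_nth by (intro tendsto_diff tendsto_mult tendsto_const tendsto_gam tendsto_del
        tendsto_inverse_powers)+
  then have lim: "((\<lambda>x. ?M x $ i $ j) \<longlongrightarrow> ?E $ i $ j) at_top"
    using exhaust_2[of i] exhaust_2[of j] by (elim disjE; simp only:)
  have E1: "?E = E 1" by (simp add: E_1)
  have "((\<lambda>x. ?M x $ i $ j) \<longlongrightarrow> E 1 $ i $ j) at_top"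
    unfolding E1[symmetric] by (rule lim)
  moreover have "eventually (\<lambda>x. ?M x $ i $ j = base_rep K x comm $ i $ j) at_top"
    using eventually_gt_at_top[of 1] by eventually_elim (simp add: rep_comm)
  ultimately show "((\<lambda>x. base_rep K x comm $ i $ j) \<longlongrightarrow> E 1 $ i $ j) at_top"
    by (rule Lim_transform_eventually)
qed

lemma comm'_pow_limit:
  "((\<lambda>x. base_rep K x (comm' [^]\<^bsub>F2\<^esub> (m::int)) $ i $ j) \<longlongrightarrow> E' m $ i $ j) at_top"
proof (rule tendsto_pow[where E = E', OF comm_closed(2) _ E'_rec])
  fix i j :: 2
  let ?M = "\<lambda>x. mat2 (del K x - gam K x * (1 / x^4)) (del K x - del K x * (1 / x\<^sup>2))
    (gam K x * (1 / x\<^sup>2) - gam K x) (del K x - gam K x)"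
  let ?E = "mat2 (1 - K * 0) (1 - 1 * 0) (K * 0 - K) (1 - K)"
  have "((\<lambda>x. ?M x $ 1 $ 1) \<longlongrightarrow> ?E $ 1 $ 1) at_top" "((\<lambda>x. ?M x $ 1 $ 2) \<longlongrightarrow> ?E $ 1 $ 2) at_top"
    "((\<lambda>x. ?M x $ 2 $ 1) \<longlongrightarrow> ?E $ 2 $ 1) at_top" "((\<lambda>x. ?M x $ 2 $ 2) \<longlongrightarrow> ?E $ 2 $ 2) at_top"
    unfolding mat2_nth by (intro tendsto_diff tendsto_mult tendsto_const tendsto_gam tendsto_del
        tendsto_inverse_powers)+
  then have lim: "((\<lambda>x. ?M x $ i $ j) \<longlongrightarrow> ?E $ i $ j) at_top"
    using exhaust_2[of i] exhaust_2[of j] by (elim disjE; simp only:)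
  have E1: "?E = E' 1" by (simp add: E'_1)
  have "((\<lambda>x. ?M x $ i $ j) \<longlongrightarrow> E' 1 $ i $ j) at_top"
    unfolding E1[symmetric] by (rule lim)
  moreover have "eventually (\<lambda>x. ?M x $ i $ j = base_rep K x comm' $ i $ j) at_top"
    using eventually_gt_at_top[of 1] by eventually_elim (simp add: rep_comm')
  ultimately show "((\<lambda>x. base_rep K x comm' $ i $ j) \<longlongrightarrow> E' 1 $ i $ j) at_top"
    by (rule Lim_transform_eventually)
qed

end


section \<open>The vertex group of the HNN extension\<close>

lemma (in group) int_pow_conjugate:
  assumes "y \<in> carrier G" "x \<in> carrier G"
  shows "y \<otimes> x [^] (n::int) \<otimes> inv y = (y \<otimes> x \<otimes> inv y) [^] n"
proof -
  have "(\<lambda>z. y \<otimes> z \<otimes> inv y) \<in> hom G G"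
    using assms by (auto simp: hom_def m_assoc inv_solve_left)
  then interpret c: group_hom G G "\<lambda>z. y \<otimes> z \<otimes> inv y"
    by unfold_locales
  show ?thesis using c.hom_int_pow[OF assms(2)] .
qed

lemma (in group) inv_mult_cancel [simp]:
  "x \<in> carrier G \<Longrightarrow> z \<in> carrier G \<Longrightarrow> inv x \<otimes> (x \<otimes> z) = z"
  "x \<in> carrier G \<Longrightarrow> z \<in> carrier G \<Longrightarrow> x \<otimes> (inv x \<otimes> z) = z"
  by (simp_all flip: m_assoc)

definition conj_X :: "generator letter list set" where
  "conj_X = gen_Y \<otimes>\<^bsub>F2\<^esub> gen_X \<otimes>\<^bsub>F2\<^esub> inv\<^bsub>F2\<^esub> gen_Y"

definition vertex_group :: "generator letter list set set" where
  "vertex_group = generate F2 {gen_X, comm}"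

definition X_powers :: "generator letter list set set" where
  "X_powers = range (\<lambda>n::int. gen_X [^]\<^bsub>F2\<^esub> n)"

definition conj_X_powers :: "generator letter list set set" where
  "conj_X_powers = range (\<lambda>n::int. conj_X [^]\<^bsub>F2\<^esub> n)"

lemma conj_X_closed [simp]: "conj_X \<in> carrier F2"
  by (simp add: conj_X_def)

lemma comm_conj_X: "comm \<otimes>\<^bsub>F2\<^esub> conj_X = gen_X"
  by (simp add: comm_def conj_X_def F2.m_assoc)

lemma comm_eq: "comm = gen_X \<otimes>\<^bsub>F2\<^esub> inv\<^bsub>F2\<^esub> conj_X"
  by (simp add: comm_def conj_X_def F2.m_assoc F2.inv_mult_group)

lemma conj_X_pow: "conj_X [^]\<^bsub>F2\<^esub> (n::int) = gen_Y \<otimes>\<^bsub>F2\<^esub> gen_X [^]\<^bsub>F2\<^esub> n \<otimes>\<^bsub>F2\<^esub> inv\<^bsub>F2\<^esub> gen_Y"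
  by (simp add: conj_X_def F2.int_pow_conjugate)

lemma subgroup_vertex_group: "subgroup vertex_group F2"
  unfolding vertex_group_def by (rule F2.generate_is_subgroup) simp

lemma vertex_group_closed: "h \<in> vertex_group \<Longrightarrow> h \<in> carrier F2"
  using subgroup.mem_carrier[OF subgroup_vertex_group] .

lemma powers_in_vertex_group: "X_powers \<subseteq> vertex_group" "conj_X_powers \<subseteq> vertex_group"
proof -
  have X: "gen_X \<in> vertex_group" and c: "comm \<in> vertex_group"
    by (auto simp: vertex_group_def intro: generate.incl)
  have "conj_X = inv\<^bsub>F2\<^esub> comm \<otimes>\<^bsub>F2\<^esub> gen_X"
    using comm_conj_X by (simp add: F2.inv_solve_left)
  then have "conj_X \<in> vertex_group"
    using subgroup.m_closed[OF subgroup_vertex_group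
        subgroup.m_inv_closed[OF subgroup_vertex_group c] X] by simp
  with X show "X_powers \<subseteq> vertex_group" "conj_X_powers \<subseteq> vertex_group"
    using F2.subgroup_int_pow_closed[OF subgroup_vertex_group]
    by (auto simp: X_powers_def conj_X_powers_def)
qed

lemma rep_vertex_group:
  assumes "h \<in> vertex_group" "x > 1" "t > 0"
  shows "rep K x t h = base_rep K x h"
proof -
  have "h \<in> generate F2 {gen_X, comm}" using assms by (simp add: vertex_group_def)
  then show ?thesis
  proof (induction h rule: generate.induct)
    case (eng g h)
    then have "g \<in> carrier F2" "h \<in> carrier F2"
      using vertex_group_closed by (auto simp: vertex_group_def)
    then show ?case using eng assms by (simp add: rep_mult)
  qed (use assms in \<open>auto simp: rep_one rep_X rep_comm rep_inv\<close>)
qed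

context irrational_angle
begin

lemma vertex_entry_12:
  assumes "h \<in> vertex_group" "h \<notin> X_powers"
  shows "eventually (\<lambda>x. base_rep K x h $ 1 $ 2 \<noteq> 0) at_top"
proof -
  have "eventually (\<lambda>x. base_rep K x h $ 1 $ 2 \<noteq> 0 \<and> base_rep K x h $ 2 $ 1 \<noteq> 0) at_top"
    using assms unfolding vertex_group_def X_powers_def
    by (intro off_diagonal_nonzero[where c = comm and E = E] comm_pow_limit E_nonzero) auto
  then show ?thesis by eventually_elim simp
qed

text \<open>Conjugation by the inverse of Y carries the vertex group into the group generated by X
  and \<open>comm'\<close>, and powers of \<open>conj_X\<close> to powers of X, which reduces the
  claim to \<open>off_diagonal_nonzero\<close>.\<close>

lemma vertex_conj_entry_21:
  assumes h: "h \<in> vertex_group" "h \<notin> conj_X_powers"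
  shows "eventually (\<lambda>x. base_rep K x (inv\<^bsub>F2\<^esub> gen_Y \<otimes>\<^bsub>F2\<^esub> (h \<otimes>\<^bsub>F2\<^esub> gen_Y)) $ 2 $ 1 \<noteq> 0) at_top"
proof -
  define k where "k = inv\<^bsub>F2\<^esub> gen_Y \<otimes>\<^bsub>F2\<^esub> (h \<otimes>\<^bsub>F2\<^esub> gen_Y)"
  have hF: "h \<in> carrier F2" using h(1) by (rule vertex_group_closed)
  have h': "h \<in> generate F2 {gen_X, comm}" using h(1) by (simp add: vertex_group_def)
  define S where "S = generate F2 {gen_X, comm'}"
  have S: "subgroup S F2" unfolding S_def by (rule F2.generate_is_subgroup) simp
  have SX: "gen_X \<in> S" and Sc: "comm' \<in> S" unfolding S_def by (auto intro: generate.incl)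
  have kS: "k \<in> S" using h' unfolding k_def
  proof (induction h rule: generate.induct)
    case (incl h)
    then consider "h = gen_X" | "h = comm" by blast
    then show ?case
    proof cases
      case 1
      have "inv\<^bsub>F2\<^esub> gen_Y \<otimes>\<^bsub>F2\<^esub> (h \<otimes>\<^bsub>F2\<^esub> gen_Y) = comm' \<otimes>\<^bsub>F2\<^esub> gen_X"
        by (simp add: 1 comm'_def F2.m_assoc)
      then show ?thesis using subgroup.m_closed[OF S Sc SX] by simp
    next
      case 2
      have "inv\<^bsub>F2\<^esub> gen_Y \<otimes>\<^bsub>F2\<^esub> (h \<otimes>\<^bsub>F2\<^esub> gen_Y) = comm'"
        by (simp add: 2 comm_def comm'_def F2.m_assoc)
      then show ?thesis using Sc by simp
    qed
  next
    case (inv h)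
    then consider "h = gen_X" | "h = comm" by blast
    then show ?case
    proof cases
      case 1
      have "inv\<^bsub>F2\<^esub> gen_Y \<otimes>\<^bsub>F2\<^esub> (inv\<^bsub>F2\<^esub> h \<otimes>\<^bsub>F2\<^esub> gen_Y) = inv\<^bsub>F2\<^esub> (comm' \<otimes>\<^bsub>F2\<^esub> gen_X)"
        by (simp add: 1 comm'_def F2.m_assoc F2.inv_mult_group)
      then show ?thesis using subgroup.m_inv_closed[OF S subgroup.m_closed[OF S Sc SX]] by simp
    next
      case 2
      have "inv\<^bsub>F2\<^esub> gen_Y \<otimes>\<^bsub>F2\<^esub> (inv\<^bsub>F2\<^esub> h \<otimes>\<^bsub>F2\<^esub> gen_Y) = inv\<^bsub>F2\<^esub> comm'"
        by (simp add: 2 comm_def comm'_def F2.m_assoc F2.inv_mult_group)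
      then show ?thesis using subgroup.m_inv_closed[OF S Sc] by simp
    qed
  next
    case (eng g h)
    then have gh: "g \<in> carrier F2" "h \<in> carrier F2"
      using vertex_group_closed by (auto simp: vertex_group_def)
    have "inv\<^bsub>F2\<^esub> gen_Y \<otimes>\<^bsub>F2\<^esub> (g \<otimes>\<^bsub>F2\<^esub> h \<otimes>\<^bsub>F2\<^esub> gen_Y) =
        (inv\<^bsub>F2\<^esub> gen_Y \<otimes>\<^bsub>F2\<^esub> (g \<otimes>\<^bsub>F2\<^esub> gen_Y)) \<otimes>\<^bsub>F2\<^esub> (inv\<^bsub>F2\<^esub> gen_Y \<otimes>\<^bsub>F2\<^esub> (h \<otimes>\<^bsub>F2\<^esub> gen_Y))"
      using gh by (simp add: F2.m_assoc)
    then show ?case using subgroup.m_closed[OF S eng.IH] by simp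
  next
    case one
    show ?case using subgroup.one_closed[OF S] by simp
  qed
  have "k \<notin> range (\<lambda>n::int. gen_X [^]\<^bsub>F2\<^esub> n)"
  proof
    assume "k \<in> range (\<lambda>n::int. gen_X [^]\<^bsub>F2\<^esub> n)"
    then obtain n :: int where "k = gen_X [^]\<^bsub>F2\<^esub> n" by blast
    then have "conj_X [^]\<^bsub>F2\<^esub> n = gen_Y \<otimes>\<^bsub>F2\<^esub> k \<otimes>\<^bsub>F2\<^esub> inv\<^bsub>F2\<^esub> gen_Y"
      by (simp add: conj_X_pow)
    also have "\<dots> = (gen_Y \<otimes>\<^bsub>F2\<^esub> inv\<^bsub>F2\<^esub> gen_Y) \<otimes>\<^bsub>F2\<^esub> h \<otimes>\<^bsub>F2\<^esub> (gen_Y \<otimes>\<^bsub>F2\<^esub> inv\<^bsub>F2\<^esub> gen_Y)"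
      using hF by (simp only: k_def F2.m_assoc F2_gen_closed F2.inv_closed F2.m_closed)
    also have "\<dots> = h" using hF by simp
    finally show False using h(2) by (auto simp: conj_X_powers_def)
  qed
  then have "eventually (\<lambda>x. base_rep K x k $ 1 $ 2 \<noteq> 0 \<and> base_rep K x k $ 2 $ 1 \<noteq> 0) at_top"
    using kS unfolding S_def
    by (intro off_diagonal_nonzero[where c = comm' and E = E'] comm'_pow_limit E_nonzero) auto
  then show ?thesis unfolding k_def by eventually_elim simp
qed

text \<open>\<open>conj_X\<close> fixes the line through \<open>Y e\<^sub>1\<close>, so \<open>h\<close> may be changed on the right by powers of
  \<open>conj_X\<close>. This is needed because the limit of \<open>comm\<close> maps the limit of that line to the
  coordinate line of \<open>e\<^sub>1\<close>.\<close>

lemma vertex_Y_entry_11: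
  assumes h: "h \<in> vertex_group"
  shows "eventually (\<lambda>x. base_rep K x (h \<otimes>\<^bsub>F2\<^esub> gen_Y) $ 1 $ 1 \<noteq> 0) at_top"
proof -
  have gt: "eventually (\<lambda>x::real. x > 1) at_top" by (rule eventually_gt_at_top)
  define v where "v = (\<lambda>x. base_rep K x gen_Y *v axis 1 1)"
  \<comment> \<open>Excludes a final syllable \<open>comm\<close> with no power of X after it: by
    \<open>comm_eq\<close> it is X times the inverse of \<open>conj_X\<close>, which the
    normalization absorbs.\<close>
  define ok :: "int \<Rightarrow> int \<Rightarrow> bool" where "ok = (\<lambda>m n. n \<noteq> 0 \<or> m \<noteq> 1)"
  let ?A = "alternating F2 gen_X comm ok"
  have "\<exists>n::int. \<exists>r\<in>conj_X_powers. h = gen_X [^]\<^bsub>F2\<^esub> n \<otimes>\<^bsub>F2\<^esub> r \<or>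
      (\<exists>u\<in>?A. h = gen_X [^]\<^bsub>F2\<^esub> n \<otimes>\<^bsub>F2\<^esub> (u \<otimes>\<^bsub>F2\<^esub> r))"
  proof (rule F2.alternating_form[OF F2_gen_closed comm_closed(1)])
    show "conj_X_powers \<subseteq> carrier F2" by (auto simp: conj_X_powers_def)
    show "\<one>\<^bsub>F2\<^esub> \<in> conj_X_powers" unfolding conj_X_powers_def by (rule range_eqI[of _ _ 0]) simp
    show "r \<otimes>\<^bsub>F2\<^esub> s \<in> conj_X_powers" if "r \<in> conj_X_powers" "s \<in> conj_X_powers" for r s
      using that by (auto simp: conj_X_powers_def simp flip: F2.int_pow_mult)
    show "h \<in> generate F2 {gen_X, comm}" using h by (simp add: vertex_group_def)
    fix m n :: int assume "\<not> ok m n"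
    then have "comm [^]\<^bsub>F2\<^esub> m \<otimes>\<^bsub>F2\<^esub> gen_X [^]\<^bsub>F2\<^esub> n = gen_X [^]\<^bsub>F2\<^esub> (1::int) \<otimes>\<^bsub>F2\<^esub> conj_X [^]\<^bsub>F2\<^esub> (-1::int)"
      by (simp add: ok_def comm_eq F2.int_pow_neg)
    then show "\<exists>n'. \<exists>r\<in>conj_X_powers. comm [^]\<^bsub>F2\<^esub> m \<otimes>\<^bsub>F2\<^esub> gen_X [^]\<^bsub>F2\<^esub> n = gen_X [^]\<^bsub>F2\<^esub> (n'::int) \<otimes>\<^bsub>F2\<^esub> r"
      unfolding conj_X_powers_def by blast
  qed
  then obtain n p :: int
    where np: "h = gen_X [^]\<^bsub>F2\<^esub> n \<otimes>\<^bsub>F2\<^esub> conj_X [^]\<^bsub>F2\<^esub> p \<or>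
      (\<exists>u\<in>?A. h = gen_X [^]\<^bsub>F2\<^esub> n \<otimes>\<^bsub>F2\<^esub> (u \<otimes>\<^bsub>F2\<^esub> conj_X [^]\<^bsub>F2\<^esub> p))"
    unfolding conj_X_powers_def by blast
  have conj_Y: "conj_X [^]\<^bsub>F2\<^esub> p \<otimes>\<^bsub>F2\<^esub> gen_Y = gen_Y \<otimes>\<^bsub>F2\<^esub> gen_X [^]\<^bsub>F2\<^esub> p"
    by (simp add: conj_X_pow F2.m_assoc)
  have v: "v x = vector [1, gam K x]" if "x > 1" for x
    using that by (simp add: v_def vec_eq_iff forall_2 rep_Y) (simp add: mat_Y_def)
  show ?thesis using np
  proof
    assume h': "h = gen_X [^]\<^bsub>F2\<^esub> n \<otimes>\<^bsub>F2\<^esub> conj_X [^]\<^bsub>F2\<^esub> p"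
    show ?thesis using gt
    proof eventually_elim
      case (elim x)
      have "h \<otimes>\<^bsub>F2\<^esub> gen_Y = gen_X [^]\<^bsub>F2\<^esub> n \<otimes>\<^bsub>F2\<^esub> (gen_Y \<otimes>\<^bsub>F2\<^esub> gen_X [^]\<^bsub>F2\<^esub> p)"
        by (simp add: h' F2.m_assoc conj_Y)
      then show ?case
        using elim by (simp add: rep_mult rep_X_pow rep_Y matrix_mult_nth2) (simp add: mat_Y_def)
    qed
  next
    assume "\<exists>u\<in>?A. h = gen_X [^]\<^bsub>F2\<^esub> n \<otimes>\<^bsub>F2\<^esub> (u \<otimes>\<^bsub>F2\<^esub> conj_X [^]\<^bsub>F2\<^esub> p)"
    then obtain u where u: "u \<in> ?A"
      and h': "h = gen_X [^]\<^bsub>F2\<^esub> n \<otimes>\<^bsub>F2\<^esub> (u \<otimes>\<^bsub>F2\<^esub> conj_X [^]\<^bsub>F2\<^esub> p)" by blast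
    have uF: "u \<in> carrier F2" using F2.alternating_closed[OF u] by simp
    have good_v: "generic_limit v"
    proof -
      have "eventually (\<lambda>x. 1 = x powi 0 * v x $ 1) at_top"
        "eventually (\<lambda>x. gam K x = x powi 0 * v x $ 2) at_top"
        using gt by (eventually_elim, simp add: v)+
      from Lim_transform_eventually[OF tendsto_const this(1)]
        Lim_transform_eventually[OF tendsto_gam this(2)]
      show ?thesis unfolding generic_limit_def
        by (intro exI[of _ 0] exI[of _ 1] exI[of _ K] conjI) (simp_all add: K_nonzero)
    qed
    have "generic_limit (\<lambda>x. base_rep K x u *v v x)"
    proof (rule alternating_generic[OF comm_closed(1) comm_pow_limit E_nonzero(1) _ u])
      fix m n :: int assume m: "m \<noteq> 0" and ok: "ok m n"
      show "generic_limit (\<lambda>x. base_rep K x (comm [^]\<^bsub>F2\<^esub> m \<otimes>\<^bsub>F2\<^esub> gen_X [^]\<^bsub>F2\<^esub> n) *v v x)"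
      proof (cases "n = 0")
        case False
        have "eventually (\<lambda>x. base_rep K x (comm [^]\<^bsub>F2\<^esub> m) *v (mat2 (x powi n) 0 0 (x powi (- n)) *v v x)
            = base_rep K x (comm [^]\<^bsub>F2\<^esub> m \<otimes>\<^bsub>F2\<^esub> gen_X [^]\<^bsub>F2\<^esub> n) *v v x) at_top"
          using gt by eventually_elim (simp add: rep_mult rep_X_pow matrix_vector_mul_assoc)
        from generic_limit_cong[OF this generic_limit_step[OF good_v False comm_pow_limit E_nonzero(1)[OF m]]]
        show ?thesis .
      next
        case True
        then have m1: "m - 1 \<noteq> 0" using ok by (simp add: ok_def)
        \<comment> \<open>One factor \<open>comm\<close> is applied to \<open>v x\<close> exactly: X
          Y X^-1 sends the first basis vector to (1, gam/x^2), which tends to that basis vector.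
          What is left is the first column of \<open>E (m - 1)\<close>, without zeros because
          \<open>m\<close> is not 1.\<close>
        have cY: "comm \<otimes>\<^bsub>F2\<^esub> gen_Y = gen_X \<otimes>\<^bsub>F2\<^esub> (gen_Y \<otimes>\<^bsub>F2\<^esub> inv\<^bsub>F2\<^esub> gen_X)"
          by (simp add: comm_def F2.m_assoc)
        have eq: "eventually (\<lambda>x. base_rep K x (comm [^]\<^bsub>F2\<^esub> (m - 1)) $ i $ 1 +
            base_rep K x (comm [^]\<^bsub>F2\<^esub> (m - 1)) $ i $ 2 * (gam K x * (1 / x\<^sup>2)) =
            x powi 0 * (base_rep K x (comm [^]\<^bsub>F2\<^esub> m \<otimes>\<^bsub>F2\<^esub> gen_X [^]\<^bsub>F2\<^esub> n) *v v x) $ i) at_top" for i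
          using gt
        proof eventually_elim
          case (elim x)
          have "comm [^]\<^bsub>F2\<^esub> m = comm [^]\<^bsub>F2\<^esub> (m - 1) \<otimes>\<^bsub>F2\<^esub> comm"
            using F2.int_pow_mult[of comm "m - 1" 1] by simp
          then have "base_rep K x (comm [^]\<^bsub>F2\<^esub> m) ** base_rep K x gen_Y =
              base_rep K x (comm [^]\<^bsub>F2\<^esub> (m - 1)) ** base_rep K x (comm \<otimes>\<^bsub>F2\<^esub> gen_Y)"
            using elim by (simp add: rep_mult matrix_mul_assoc)
          moreover have "base_rep K x (comm \<otimes>\<^bsub>F2\<^esub> gen_Y) $ 1 $ 1 = 1"
            "base_rep K x (comm \<otimes>\<^bsub>F2\<^esub> gen_Y) $ 2 $ 1 = gam K x * (1 / x\<^sup>2)"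
            unfolding cY using elim
            by (simp_all add: rep_mult rep_X rep_Y rep_X_inv matrix_mult_nth2)
              (simp_all add: mat_X_def mat_Y_def power2_eq_square)
          ultimately show ?case
            using True elim by (simp add: v_def matrix_vector_mul_assoc) (simp add: matrix_mult_nth2)
        qed
        have lim: "((\<lambda>x. base_rep K x (comm [^]\<^bsub>F2\<^esub> (m - 1)) $ i $ 1 +
            base_rep K x (comm [^]\<^bsub>F2\<^esub> (m - 1)) $ i $ 2 * (gam K x * (1 / x\<^sup>2))) \<longlongrightarrow>
            E (m - 1) $ i $ 1 + E (m - 1) $ i $ 2 * (K * 0)) at_top" for i
          by (intro tendsto_add tendsto_mult comm_pow_limit tendsto_gam tendsto_inverse_powers)
        have "E (m - 1) $ i $ 1 + E (m - 1) $ i $ 2 * (K * 0) \<noteq> 0" for i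
          using E_nonzero(1)[OF m1] by simp
        then show ?thesis
          using Lim_transform_eventually[OF lim eq, of 1] Lim_transform_eventually[OF lim eq, of 2]
          unfolding generic_limit_def by blast
      qed
    qed
    from gt generic_limit_nonzero[OF this] show ?thesis
    proof eventually_elim
      case (elim x)
      have "h \<otimes>\<^bsub>F2\<^esub> gen_Y = gen_X [^]\<^bsub>F2\<^esub> n \<otimes>\<^bsub>F2\<^esub> ((u \<otimes>\<^bsub>F2\<^esub> gen_Y) \<otimes>\<^bsub>F2\<^esub> gen_X [^]\<^bsub>F2\<^esub> p)"
        using uF by (simp add: h' F2.m_assoc conj_Y)
      moreover have "base_rep K x (u \<otimes>\<^bsub>F2\<^esub> gen_Y) $ 1 $ 1 \<noteq> 0"
        using elim uF by (simp add: v_def matrix_vector_mul_assoc rep_mult)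
      ultimately show ?case
        using elim uF by (simp add: rep_mult[of x 1 "gen_X [^]\<^bsub>F2\<^esub> n"]
            rep_mult[of x 1 "u \<otimes>\<^bsub>F2\<^esub> gen_Y"] rep_X_pow matrix_mult_nth2)
    qed
  qed
qed

text \<open>Inversion in SL(2) exchanges the diagonal entries, so this is
  \<open>vertex_Y_entry_11\<close> for the inverse of \<open>h\<close>.\<close>

lemma Y_vertex_entry_22:
  assumes h: "h \<in> vertex_group"
  shows "eventually (\<lambda>x. base_rep K x (inv\<^bsub>F2\<^esub> gen_Y \<otimes>\<^bsub>F2\<^esub> h) $ 2 $ 2 \<noteq> 0) at_top"
proof -
  have hF: "h \<in> carrier F2" using h by (rule vertex_group_closed)
  have "inv\<^bsub>F2\<^esub> h \<in> vertex_group"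
    using subgroup.m_inv_closed[OF subgroup_vertex_group h] .
  from vertex_Y_entry_11[OF this] eventually_gt_at_top[of 1] show ?thesis
  proof eventually_elim
    case (elim x)
    have "inv\<^bsub>F2\<^esub> gen_Y \<otimes>\<^bsub>F2\<^esub> h = inv\<^bsub>F2\<^esub> (inv\<^bsub>F2\<^esub> h \<otimes>\<^bsub>F2\<^esub> gen_Y)"
      using hF by (simp add: F2.inv_mult_group)
    then show ?case using elim hF by (simp add: rep_inv)
  qed
qed


section \<open>Degeneration as the twist grows\<close>

text \<open>The direction in which a stable letter stretches as t grows. Since Y at t is Y at 1
  times diag(t, 1/t), it is the first column of Y at 1 for Y, and the second basis vector for the
  inverse of Y.\<close>

definition end_vector :: "real \<Rightarrow> bool \<Rightarrow> real^2" where
  "end_vector x e = (if e then vector [1, gam K x] else vector [0, 1])"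

text \<open>The limit direction is recorded along with the rate, because it decides whether the next
  syllable preserves the growth. The vector \<open>z\<close> must not depend on t.\<close>

definition grows :: "real \<Rightarrow> bool \<Rightarrow> generator letter list set \<Rightarrow> bool" where
  "grows x e u \<longleftrightarrow> (\<exists>z s. \<exists>k>0. s \<noteq> 0 \<and>
     (\<forall>i. ((\<lambda>t. (rep K x t u *v z) $ i / t ^ k) \<longlongrightarrow> s * end_vector x e $ i) at_top))"

lemma grows_base:
  assumes x: "x > 1" and h: "h \<in> vertex_group"
  shows "grows x e (signed F2 gen_Y e \<otimes>\<^bsub>F2\<^esub> h)"
proof -
  have hF: "h \<in> carrier F2" using h by (rule vertex_group_closed)
  define j :: 2 where "j = (if e then 1 else 2)"
  \<comment> \<open>Chosen so that \<open>h\<close> maps it to a basis vector, the one that the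
    stable letter stretches.\<close>
  define z where "z = base_rep K x (inv\<^bsub>F2\<^esub> h) *v axis j 1"
  have hi: "inv\<^bsub>F2\<^esub> h \<in> vertex_group"
    using subgroup.m_inv_closed[OF subgroup_vertex_group h] .
  have z: "rep K x t (signed F2 gen_Y e \<otimes>\<^bsub>F2\<^esub> h) *v z = rep K x t (signed F2 gen_Y e) *v axis j 1"
    if t: "t > 0" for t
  proof -
    have "rep K x t (signed F2 gen_Y e \<otimes>\<^bsub>F2\<^esub> h) ** rep K x t (inv\<^bsub>F2\<^esub> h) =
        rep K x t ((signed F2 gen_Y e \<otimes>\<^bsub>F2\<^esub> h) \<otimes>\<^bsub>F2\<^esub> inv\<^bsub>F2\<^esub> h)"
      using hF by (intro rep_mult[OF x t, symmetric]) auto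
    also have "(signed F2 gen_Y e \<otimes>\<^bsub>F2\<^esub> h) \<otimes>\<^bsub>F2\<^esub> inv\<^bsub>F2\<^esub> h = signed F2 gen_Y e"
      using hF by (subst F2.m_assoc) auto
    finally show ?thesis
      by (simp add: z_def matrix_vector_mul_assoc rep_vertex_group[OF hi x t])
  qed
  have gt: "eventually (\<lambda>t::real. t > 0) at_top" by (rule eventually_gt_at_top)
  have small: "((\<lambda>t::real. - (1 / x\<^sup>2) * (1 / t\<^sup>2)) \<longlongrightarrow> - (1 / x\<^sup>2) * 0) at_top"
    by (intro tendsto_mult tendsto_const tendsto_inverse_powers)
  have "((\<lambda>t. (rep K x t (signed F2 gen_Y e \<otimes>\<^bsub>F2\<^esub> h) *v z) $ i / t ^ 1) \<longlongrightarrow> 1 * end_vector x e $ i) at_top" for i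
  proof -
    consider "e" | "\<not> e" "i = 1" | "\<not> e" "i = 2" using exhaust_2 by blast
    then show ?thesis
    proof cases
      case 1
      have "eventually (\<lambda>t. end_vector x e $ i = (rep K x t (signed F2 gen_Y e \<otimes>\<^bsub>F2\<^esub> h) *v z) $ i / t ^ 1) at_top"
        using gt
      proof eventually_elim
        case (elim t)
        then show ?case unfolding z[OF elim] using 1 x exhaust_2[of i]
          by (auto simp: rep_Y j_def end_vector_def mat_Y_def)
      qed
      from Lim_transform_eventually[OF tendsto_const this] show ?thesis by simp
    next
      case 2
      have "eventually (\<lambda>t. - (1 / x\<^sup>2) * (1 / t\<^sup>2) = (rep K x t (signed F2 gen_Y e \<otimes>\<^bsub>F2\<^esub> h) *v z) $ i / t ^ 1) at_top"
        using gt
      proof eventually_elim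
        case (elim t)
        then show ?case unfolding z[OF elim] using 2 x
          by (auto simp: rep_Y_inv j_def power2_eq_square)
      qed
      from Lim_transform_eventually[OF small this] show ?thesis using 2 by (simp add: end_vector_def)
    next
      case 3
      have "eventually (\<lambda>t. 1 = (rep K x t (signed F2 gen_Y e \<otimes>\<^bsub>F2\<^esub> h) *v z) $ i / t ^ 1) at_top"
        using gt
      proof eventually_elim
        case (elim t)
        then show ?case unfolding z[OF elim] using 3 x
          by (auto simp: rep_Y_inv j_def)
      qed
      from Lim_transform_eventually[OF tendsto_const this] show ?thesis using 3 by (simp add: end_vector_def)
    qed
  qed
  then show ?thesis unfolding grows_def
    by (intro exI[of _ z] exI[of _ 1] conjI allI) simp_all
qed

text \<open>The new stable letter multiplies the limit direction, moved by \<open>h\<close>, by t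
  times one coordinate: the first one for Y, and for the inverse of Y the second one after applying
  that inverse at t = 1. The assumption \<open>nz\<close> says that this coordinate is not 0, so the
  degree in t rises by one.\<close>

lemma grows_step:
  assumes x: "x > 1" and u: "u \<in> carrier F2" "grows x e' u" and h: "h \<in> vertex_group"
    and nz: "(if e then (base_rep K x h *v end_vector x e') $ 1
      else (base_rep K x (inv\<^bsub>F2\<^esub> gen_Y \<otimes>\<^bsub>F2\<^esub> h) *v end_vector x e') $ 2) \<noteq> 0"
  shows "grows x e (signed F2 gen_Y e \<otimes>\<^bsub>F2\<^esub> (h \<otimes>\<^bsub>F2\<^esub> u))"
proof -
  have hF: "h \<in> carrier F2" using h by (rule vertex_group_closed)
  obtain z s k where k: "k > 0" and s: "s \<noteq> 0"
    and lim: "\<And>i. ((\<lambda>t. (rep K x t u *v z) $ i / t ^ k) \<longlongrightarrow> s * end_vector x e' $ i) at_top"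
    using u(2) unfolding grows_def by blast
  define H where "H = base_rep K x h"
  define p where "p = (\<lambda>t. H *v (rep K x t u *v z))"
  define q where "q = H *v end_vector x e'"
  have p: "((\<lambda>t. p t $ i / t ^ k) \<longlongrightarrow> s * q $ i) at_top" for i
    using tendsto_add[OF tendsto_mult[OF tendsto_const[of "H $ i $ 1"] lim[of 1]]
        tendsto_mult[OF tendsto_const[of "H $ i $ 2"] lim[of 2]]]
    by (simp add: p_def q_def matrix_vector_mult_nth2 add_divide_distrib algebra_simps)
  have small: "((\<lambda>t::real. 1 / t\<^sup>2) \<longlongrightarrow> 0) at_top" by (rule tendsto_inverse_powers)
  have gt: "eventually (\<lambda>t::real. t > 0) at_top" by (rule eventually_gt_at_top)
  let ?w = "signed F2 gen_Y e \<otimes>\<^bsub>F2\<^esub> (h \<otimes>\<^bsub>F2\<^esub> u)"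
  have w: "rep K x t ?w *v z = rep K x t (signed F2 gen_Y e) *v p t" if t: "t > 0" for t
  proof -
    have "rep K x t ?w = rep K x t (signed F2 gen_Y e) ** (H ** rep K x t u)"
      using hF u(1) rep_vertex_group[OF h x t] by (simp add: rep_mult[OF x t] H_def)
    then show ?thesis by (simp add: p_def matrix_vector_mul_assoc matrix_mul_assoc)
  qed
  show ?thesis
  proof (cases e)
    case True
    have 1: "((\<lambda>t. (rep K x t ?w *v z) $ 1 / t ^ Suc k) \<longlongrightarrow> s * q $ 1) at_top"
    proof (rule Lim_transform_eventually)
      show "((\<lambda>t. p t $ 1 / t ^ k + (1 / x\<^sup>2) * ((1 / t\<^sup>2) * (p t $ 2 / t ^ k))) \<longlongrightarrow> s * q $ 1) at_top"
        using tendsto_add[OF p[of 1] tendsto_mult[OF tendsto_const[of "1 / x\<^sup>2"] tendsto_mult[OF small p[of 2]]]]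
        by simp
      show "eventually (\<lambda>t. p t $ 1 / t ^ k + (1 / x\<^sup>2) * ((1 / t\<^sup>2) * (p t $ 2 / t ^ k)) =
          (rep K x t ?w *v z) $ 1 / t ^ Suc k) at_top"
        using gt
      proof eventually_elim
        case (elim t)
        show ?case unfolding w[OF elim] using elim x True
          by (simp add: rep_Y matrix_vector_mult_nth2)
            (simp add: mat_Y_def power2_eq_square field_simps)
      qed
    qed
    have 2: "((\<lambda>t. (rep K x t ?w *v z) $ 2 / t ^ Suc k) \<longlongrightarrow> s * q $ 1 * gam K x) at_top"
    proof (rule Lim_transform_eventually)
      show "((\<lambda>t. gam K x * (p t $ 1 / t ^ k) + del K x * ((1 / t\<^sup>2) * (p t $ 2 / t ^ k))) \<longlongrightarrow> s * q $ 1 * gam K x) at_top"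
        using tendsto_add[OF tendsto_mult[OF tendsto_const[of "gam K x"] p[of 1]]
            tendsto_mult[OF tendsto_const[of "del K x"] tendsto_mult[OF small p[of 2]]]]
        by (simp add: mult_ac)
      show "eventually (\<lambda>t. gam K x * (p t $ 1 / t ^ k) + del K x * ((1 / t\<^sup>2) * (p t $ 2 / t ^ k)) =
          (rep K x t ?w *v z) $ 2 / t ^ Suc k) at_top"
        using gt
      proof eventually_elim
        case (elim t)
        show ?case unfolding w[OF elim] using elim x True
          by (simp add: rep_Y matrix_vector_mult_nth2)
            (simp add: mat_Y_def power2_eq_square field_simps)
      qed
    qed
    have lim': "((\<lambda>t. (rep K x t ?w *v z) $ i / t ^ Suc k) \<longlongrightarrow> (s * q $ 1) * end_vector x e $ i) at_top" for i
      using 1 2 exhaust_2[of i] True by (auto simp: end_vector_def)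
    have nz': "s * q $ 1 \<noteq> 0" using nz s True by (simp add: q_def H_def)
    show ?thesis unfolding grows_def
      by (intro exI[of _ z] exI[of _ "s * q $ 1"] exI[of _ "Suc k"] conjI allI lim' nz' zero_less_Suc)
  next
    case False
    define r where "r = - gam K x * q $ 1 + q $ 2"
    have 1: "((\<lambda>t. (rep K x t ?w *v z) $ 1 / t ^ Suc k) \<longlongrightarrow> 0) at_top"
    proof (rule Lim_transform_eventually)
      show "((\<lambda>t. del K x * ((1 / t\<^sup>2) * (p t $ 1 / t ^ k)) +
          (- 1 / x\<^sup>2) * ((1 / t\<^sup>2) * (p t $ 2 / t ^ k))) \<longlongrightarrow> 0) at_top"
        using tendsto_add[OF tendsto_mult[OF tendsto_const[of "del K x"] tendsto_mult[OF small p[of 1]]]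
            tendsto_mult[OF tendsto_const[of "- 1 / x\<^sup>2"] tendsto_mult[OF small p[of 2]]]]
        by simp
      show "eventually (\<lambda>t. del K x * ((1 / t\<^sup>2) * (p t $ 1 / t ^ k)) +
          (- 1 / x\<^sup>2) * ((1 / t\<^sup>2) * (p t $ 2 / t ^ k)) =
          (rep K x t ?w *v z) $ 1 / t ^ Suc k) at_top"
        using gt
      proof eventually_elim
        case (elim t)
        show ?case unfolding w[OF elim] using elim x False
          by (simp add: rep_Y_inv matrix_vector_mult_nth2)
            (simp add: power2_eq_square field_simps)
      qed
    qed
    have 2: "((\<lambda>t. (rep K x t ?w *v z) $ 2 / t ^ Suc k) \<longlongrightarrow> s * r) at_top"
    proof (rule Lim_transform_eventually)
      show "((\<lambda>t. - gam K x * (p t $ 1 / t ^ k) + p t $ 2 / t ^ k) \<longlongrightarrow> s * r) at_top"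
        using tendsto_add[OF tendsto_mult[OF tendsto_const[of "- gam K x"] p[of 1]] p[of 2]]
        by (simp add: r_def algebra_simps)
      show "eventually (\<lambda>t. - gam K x * (p t $ 1 / t ^ k) + p t $ 2 / t ^ k =
          (rep K x t ?w *v z) $ 2 / t ^ Suc k) at_top"
        using gt
      proof eventually_elim
        case (elim t)
        show ?case unfolding w[OF elim] using elim x False
          by (simp add: rep_Y_inv matrix_vector_mult_nth2) (simp add: field_simps)
      qed
    qed
    have lim': "((\<lambda>t. (rep K x t ?w *v z) $ i / t ^ Suc k) \<longlongrightarrow> (s * r) * end_vector x e $ i) at_top" for i
      using 1 2 exhaust_2[of i] False by (auto simp: end_vector_def)
    have nz': "s * r \<noteq> 0"
    proof -
      have "(base_rep K x (inv\<^bsub>F2\<^esub> gen_Y \<otimes>\<^bsub>F2\<^esub> h) *v end_vector x e') $ 2 =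
          (base_rep K x (inv\<^bsub>F2\<^esub> gen_Y) *v q) $ 2"
        using hF x by (simp add: rep_mult q_def H_def matrix_vector_mul_assoc)
      also have "\<dots> = r" using x by (simp add: rep_Y_inv r_def matrix_vector_mult_nth2)
      finally show ?thesis using nz s False by simp
    qed
    show ?thesis unfolding grows_def
      by (intro exI[of _ z] exI[of _ "s * r"] exI[of _ "Suc k"] conjI allI lim' nz' zero_less_Suc)
  qed
qed

lemma end_vector_eq:
  assumes "x > 1"
  shows "end_vector x True = base_rep K x gen_Y *v axis 1 1" "end_vector x False = axis 2 1"
proof -
  show "end_vector x True = base_rep K x gen_Y *v axis 1 1"
    using assms by (simp add: end_vector_def vec_eq_iff forall_2 rep_Y) (simp add: mat_Y_def)
  show "end_vector x False = axis 2 1"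
    by (simp add: end_vector_def vec_eq_iff forall_2 axis_def)
qed

abbreviation reduced :: "bool \<Rightarrow> generator letter list set \<Rightarrow> bool" where
  "reduced \<equiv> britton F2 gen_Y vertex_group X_powers conj_X_powers"

lemma reduced_closed: "reduced e u \<Longrightarrow> u \<in> carrier F2"
  using F2.britton_closed[OF _ F2_gen_closed] vertex_group_closed by blast

text \<open>Each syllable excludes some values of x, none of them large; the induction intersects
  finitely many such conditions before t enters.\<close>

lemma reduced_grows: "reduced e u \<Longrightarrow> eventually (\<lambda>x. grows x e u) at_top"
proof (induction rule: britton.induct)
  case (base h e)
  show ?case using eventually_gt_at_top[of 1] by eventually_elim (rule grows_base[OF _ base])
next
  case (step e' u h e)
  have uF: "u \<in> carrier F2" using reduced_closed step by blast
  have hF: "h \<in> carrier F2" using step vertex_group_closed by blast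
  have gt: "eventually (\<lambda>x::real. x > 1) at_top" by (rule eventually_gt_at_top)
  have "eventually (\<lambda>x. (if e then (base_rep K x h *v end_vector x e') $ 1
      else (base_rep K x (inv\<^bsub>F2\<^esub> gen_Y \<otimes>\<^bsub>F2\<^esub> h) *v end_vector x e') $ 2) \<noteq> 0) at_top"
  proof -
    \<comment> \<open>In this order the turns are \<open>Y h Y\<close>, \<open>Y h Y^-1\<close>,
      \<open>Y^-1 h Y\<close> and \<open>Y^-1 h Y^-1\<close>. A pinch is possible only in the middle
      two, where its absence supplies the hypothesis on \<open>h\<close>.\<close>
    consider "e" "e'" | "e" "\<not> e'" | "\<not> e" "e'" | "\<not> e" "\<not> e'" by blast
    then show ?thesis
    proof cases
      case 1
      from gt vertex_Y_entry_11[OF step(2)] show ?thesis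
        by eventually_elim (simp add: 1 end_vector_eq hF rep_mult matrix_vector_mul_assoc)
    next
      case 2
      from gt vertex_entry_12[OF step(2) step(3)[OF 2]] show ?thesis
        by eventually_elim (simp add: 2 end_vector_eq)
    next
      case 3
      from gt vertex_conj_entry_21[OF step(2) step(4)[OF 3]] show ?thesis
        by eventually_elim (simp add: 3 end_vector_eq hF rep_mult matrix_vector_mul_assoc matrix_mul_assoc)
    next
      case 4
      from gt Y_vertex_entry_22[OF step(2)] show ?thesis
        by eventually_elim (simp add: 4 end_vector_eq)
    qed
  qed
  from gt step(5) this show ?case
    by eventually_elim (rule grows_step[OF _ uF _ step(2)])
qed

section \<open>Normal form in the free group and nontriviality at one point\<close>

lemma F2_normal_form:
  assumes "w \<in> carrier F2"
  shows "w \<in> vertex_group \<or> (\<exists>h\<in>vertex_group. \<exists>e u. reduced e u \<and> w = h \<otimes>\<^bsub>F2\<^esub> u)"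
    (is "?P w")
proof -
  have left: "?P (g \<otimes>\<^bsub>F2\<^esub> w)" if g: "g \<in> vertex_group" and w: "?P w" for g w
    using w
  proof
    assume "w \<in> vertex_group"
    then show ?thesis using subgroup.m_closed[OF subgroup_vertex_group g] by simp
  next
    assume "\<exists>h\<in>vertex_group. \<exists>e u. reduced e u \<and> w = h \<otimes>\<^bsub>F2\<^esub> u"
    then obtain h e u where h: "h \<in> vertex_group" and u: "reduced e u" "w = h \<otimes>\<^bsub>F2\<^esub> u"
      by blast
    have "g \<otimes>\<^bsub>F2\<^esub> w = (g \<otimes>\<^bsub>F2\<^esub> h) \<otimes>\<^bsub>F2\<^esub> u"
      using vertex_group_closed[OF g] vertex_group_closed[OF h] reduced_closed[OF u(1)]
      by (simp add: u(2) F2.m_assoc)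
    then show ?thesis using subgroup.m_closed[OF subgroup_vertex_group g h] u(1) by blast
  qed
  have gX: "gen_X \<in> vertex_group" by (auto simp: vertex_group_def intro: generate.incl)
  have c1: "gen_Y \<otimes>\<^bsub>F2\<^esub> h \<otimes>\<^bsub>F2\<^esub> inv\<^bsub>F2\<^esub> gen_Y \<in> vertex_group" if "h \<in> X_powers" for h
  proof -
    have "gen_Y \<otimes>\<^bsub>F2\<^esub> h \<otimes>\<^bsub>F2\<^esub> inv\<^bsub>F2\<^esub> gen_Y \<in> conj_X_powers"
      using that by (auto simp: X_powers_def conj_X_powers_def simp flip: conj_X_pow)
    then show ?thesis using powers_in_vertex_group by blast
  qed
  have c2: "inv\<^bsub>F2\<^esub> gen_Y \<otimes>\<^bsub>F2\<^esub> h \<otimes>\<^bsub>F2\<^esub> gen_Y \<in> vertex_group" if "h \<in> conj_X_powers" for h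
  proof -
    have "inv\<^bsub>F2\<^esub> gen_Y \<otimes>\<^bsub>F2\<^esub> h \<otimes>\<^bsub>F2\<^esub> gen_Y \<in> X_powers"
      using that by (auto simp: X_powers_def conj_X_powers_def conj_X_pow F2.m_assoc)
    then show ?thesis using powers_in_vertex_group by blast
  qed
  note step = F2.britton_form[OF F2_gen_closed subgroup_vertex_group powers_in_vertex_group c1 c2]
  show ?thesis using assms
  proof (induction w rule: F2_induct)
    case one
    show ?case using subgroup.one_closed[OF subgroup_vertex_group] by simp
  next
    case (X w)
    show ?case by (rule left[OF gX X(2)])
  next
    case (X_inv w)
    show ?case by (rule left[OF subgroup.m_inv_closed[OF subgroup_vertex_group gX] X_inv(2)])
  next
    case (Y w)
    show ?case using step[of w True] Y(2) by simp
  next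
    case (Y_inv w)
    show ?case using step[of w False] Y_inv(2) by simp
  qed
qed

text \<open>The main case is \<open>w = h u\<close> with \<open>u\<close> reduced. If
  \<open>w\<close> were trivial for every t, then \<open>u\<close> would act as plus or minus a
  matrix independent of t, against its growth.\<close>

lemma generically_faithful:
  assumes w: "w \<in> carrier F2" "w \<noteq> \<one>\<^bsub>F2\<^esub>"
  shows "\<exists>x>1. \<exists>t>0. rep K x t w \<noteq> mat 1 \<and> rep K x t w \<noteq> - mat 1"
proof -
  have gt: "eventually (\<lambda>x::real. x > 1) at_top" by (rule eventually_gt_at_top)
  consider "w \<in> X_powers" | "w \<in> vertex_group" "w \<notin> X_powers"
    | h e u where "h \<in> vertex_group" "reduced e u" "w = h \<otimes>\<^bsub>F2\<^esub> u"
    using F2_normal_form[OF w(1)] by blast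
  then show ?thesis
  proof cases
    case 1
    then obtain n :: int where n: "w = gen_X [^]\<^bsub>F2\<^esub> n" by (auto simp: X_powers_def)
    then have "n \<noteq> 0" using w by auto
    then have "(2::real) powi n \<noteq> 1"
      using powr_real_of_int'[of 2 n] by (auto simp flip: powr_real_of_int')
    moreover have "(2::real) powi n \<noteq> - 1"
    proof -
      have "(2::real) powi n > 0" by simp
      then show ?thesis by linarith
    qed
    ultimately have "base_rep K 2 w $ 1 $ 1 \<noteq> 1" "base_rep K 2 w $ 1 $ 1 \<noteq> - 1"
      unfolding n by (auto simp: rep_X_pow)
    then show ?thesis by (intro exI[of _ 2] conjI exI[of _ 1]) auto
  next
    case 2
    obtain x where "x > 1" "base_rep K x w $ 1 $ 2 \<noteq> 0"
      using eventually_happens[OF eventually_conj[OF gt vertex_entry_12[OF 2]]] by auto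
    then show ?thesis by (intro exI[of _ x] conjI exI[of _ 1]) auto
  next
    case (3 h e u)
    obtain x where x: "x > 1" and g: "grows x e u"
      using eventually_happens[OF eventually_conj[OF gt reduced_grows[OF 3(2)]]] by auto
    obtain z s k where k: "k > 0" and s: "s \<noteq> 0"
      and lim: "\<And>i. ((\<lambda>t. (rep K x t u *v z) $ i / t ^ k) \<longlongrightarrow> s * end_vector x e $ i) at_top"
      using g unfolding grows_def by blast
    have hF: "h \<in> carrier F2" and uF: "u \<in> carrier F2"
      using vertex_group_closed[OF 3(1)] reduced_closed[OF 3(2)] by auto
    have hi: "inv\<^bsub>F2\<^esub> h \<in> vertex_group"
      using subgroup.m_inv_closed[OF subgroup_vertex_group 3(1)] .
    define H where "H = base_rep K x (inv\<^bsub>F2\<^esub> h)"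
    show ?thesis
    proof (rule ccontr)
      assume "\<not> ?thesis"
      then have triv: "rep K x t w = mat 1 \<or> rep K x t w = - mat 1" if "t > 0" for t
        using that x by blast
      define i :: 2 where "i = (if e then 1 else 2)"
      have i: "end_vector x e $ i = 1" by (auto simp: end_vector_def i_def)
      have "eventually (\<lambda>t. \<bar>(H *v z) $ i\<bar> * (1 / t ^ k) = \<bar>(rep K x t u *v z) $ i / t ^ k\<bar>) at_top"
        using eventually_gt_at_top[of 0]
      proof eventually_elim
        case (elim t)
        have "u = inv\<^bsub>F2\<^esub> h \<otimes>\<^bsub>F2\<^esub> w" using hF uF by (simp add: 3(3))
        then have "rep K x t u = H ** rep K x t w"
          using rep_mult[OF x elim _ w(1), of "inv\<^bsub>F2\<^esub> h" K] hF rep_vertex_group[OF hi x elim]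
          by (simp add: H_def)
        then have "rep K x t u = H \<or> rep K x t u = - H"
          using triv[OF elim] by (auto simp: neg_matrix_mul)
        then have "\<bar>(rep K x t u *v z) $ i\<bar> = \<bar>(H *v z) $ i\<bar>"
          by (auto simp: matrix_vector_mult_nth2)
        then show ?case using elim by (simp add: abs_divide)
      qed
      moreover have "((\<lambda>t::real. \<bar>(H *v z) $ i\<bar> * (1 / t ^ k)) \<longlongrightarrow> \<bar>(H *v z) $ i\<bar> * 0) at_top"
        using tendsto_inverse_0_at_top[OF filterlim_pow_at_top[OF k filterlim_ident]]
        by (intro tendsto_mult tendsto_const) (simp add: inverse_eq_divide)
      ultimately have "((\<lambda>t. \<bar>(rep K x t u *v z) $ i / t ^ k\<bar>) \<longlongrightarrow> 0) at_top"
        using Lim_transform_eventually[of _ "\<bar>(H *v z) $ i\<bar> * 0"] by simp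
      moreover have "((\<lambda>t. \<bar>(rep K x t u *v z) $ i / t ^ k\<bar>) \<longlongrightarrow> \<bar>s\<bar>) at_top"
        using tendsto_rabs[OF lim[of i]] by (simp add: i)
      ultimately show False
        using s tendsto_unique[OF trivial_limit_at_top_linorder] by fastforce
    qed
  qed
qed

end


section \<open>Rigidity of relations\<close>

definition rational_on :: "real set \<Rightarrow> (real \<Rightarrow> real) \<Rightarrow> bool" where
  "rational_on S f \<longleftrightarrow> (\<exists>p q. \<forall>x\<in>S. poly q x \<noteq> 0 \<and> f x = poly p x / poly q x)"

lemma rational_onI:
  assumes "\<And>x. x \<in> S \<Longrightarrow> poly q x \<noteq> 0" "\<And>x. x \<in> S \<Longrightarrow> f x = poly p x / poly q x"
  shows "rational_on S f"
  unfolding rational_on_def using assms by (intro exI[of _ p] exI[of _ q]) simp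

lemma rational_on_cong:
  "rational_on S f \<Longrightarrow> (\<And>x. x \<in> S \<Longrightarrow> f x = g x) \<Longrightarrow> rational_on S g"
  by (simp add: rational_on_def)

lemma rational_on_const: "rational_on S (\<lambda>_. c)"
  by (rule rational_onI[of _ 1 _ "[:c:]"]) auto

lemma rational_on_ident: "rational_on S (\<lambda>x. x)"
  by (rule rational_onI[of _ 1 _ "[:0, 1:]"]) auto

lemma rational_on_mult:
  assumes "rational_on S f" "rational_on S g"
  shows "rational_on S (\<lambda>x. f x * g x)"
proof -
  obtain p q where "\<forall>x\<in>S. poly q x \<noteq> 0 \<and> f x = poly p x / poly q x"
    using assms(1) by (auto simp: rational_on_def)
  moreover obtain p' q' where "\<forall>x\<in>S. poly q' x \<noteq> 0 \<and> g x = poly p' x / poly q' x"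
    using assms(2) by (auto simp: rational_on_def)
  ultimately show ?thesis
    by (intro rational_onI[of _ "q * q'" _ "p * p'"]) auto
qed

lemma rational_on_add:
  assumes "rational_on S f" "rational_on S g"
  shows "rational_on S (\<lambda>x. f x + g x)"
proof -
  obtain p q where "\<forall>x\<in>S. poly q x \<noteq> 0 \<and> f x = poly p x / poly q x"
    using assms(1) by (auto simp: rational_on_def)
  moreover obtain p' q' where "\<forall>x\<in>S. poly q' x \<noteq> 0 \<and> g x = poly p' x / poly q' x"
    using assms(2) by (auto simp: rational_on_def)
  ultimately show ?thesis
    by (intro rational_onI[of _ "q * q'" _ "p * q' + p' * q"]) (auto simp: add_frac_eq)
qed

lemma rational_on_minus: "rational_on S f \<Longrightarrow> rational_on S (\<lambda>x. - f x)"
  using rational_on_mult[OF rational_on_const[of S "-1"]] by simp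

lemma rational_on_diff:
  "rational_on S f \<Longrightarrow> rational_on S g \<Longrightarrow> rational_on S (\<lambda>x. f x - g x)"
  using rational_on_add[of S f "\<lambda>x. - g x"] by (simp add: rational_on_minus)

lemma rational_on_zero:
  assumes f: "rational_on S f" and A: "infinite A" "A \<subseteq> S" "\<And>x. x \<in> A \<Longrightarrow> f x = 0"
    and x: "x \<in> S"
  shows "f x = 0"
proof -
  obtain p q where pq: "\<forall>x\<in>S. poly q x \<noteq> 0 \<and> f x = poly p x / poly q x"
    using f by (auto simp: rational_on_def)
  then have "A \<subseteq> {x. poly p x = 0}" using A by fastforce
  then have "p = 0" using poly_roots_finite A(1) finite_subset by blast
  then show ?thesis using pq x by simp
qed

text \<open>\<open>X\<close> and \<open>T\<close> are functions of one parameter so that a single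
  induction serves both the variation of x and that of t.\<close>

lemma rational_on_rep:
  assumes S: "\<And>s. s \<in> S \<Longrightarrow> X s > 1 \<and> T s > 0"
    and r: "rational_on S X" "rational_on S (\<lambda>s. 1 / X s)" "rational_on S T" "rational_on S (\<lambda>s. 1 / T s)"
      "rational_on S (\<lambda>s. gam K (X s))" "rational_on S (\<lambda>s. del K (X s))"
    and w: "w \<in> carrier F2"
  shows "rational_on S (\<lambda>s. rep K (X s) (T s) w $ i $ j)"
  using w
proof (induction w arbitrary: i j rule: F2_induct)
  case one
  show ?case
    by (rule rational_on_cong[OF rational_on_const[of _ "(mat 1 :: real^2^2) $ i $ j"]])
      (use S in \<open>simp add: rep_one\<close>)
next
  case (X w)
  have "rational_on S (\<lambda>s. mat_X (X s) $ i $ 1 * rep K (X s) (T s) w $ 1 $ j +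
      mat_X (X s) $ i $ 2 * rep K (X s) (T s) w $ 2 $ j)"
    using exhaust_2[of i]
    by (auto simp: mat_X_def intro!: rational_on_add rational_on_mult rational_on_const r X.IH)
  moreover have "mat_X (X s) $ i $ 1 * rep K (X s) (T s) w $ 1 $ j +
      mat_X (X s) $ i $ 2 * rep K (X s) (T s) w $ 2 $ j =
      rep K (X s) (T s) (gen_X \<otimes>\<^bsub>F2\<^esub> w) $ i $ j" if "s \<in> S" for s
    using S[OF that] X by (simp add: rep_mult rep_X matrix_mult_nth2)
  ultimately show ?case by (rule rational_on_cong)
next
  case (X_inv w)
  have "rational_on S (\<lambda>s. mat2 (1 / X s) 0 0 (X s) $ i $ 1 * rep K (X s) (T s) w $ 1 $ j +
      mat2 (1 / X s) 0 0 (X s) $ i $ 2 * rep K (X s) (T s) w $ 2 $ j)"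
    using exhaust_2[of i]
    by (auto intro!: rational_on_add rational_on_mult rational_on_const r X_inv.IH)
  moreover have "mat2 (1 / X s) 0 0 (X s) $ i $ 1 * rep K (X s) (T s) w $ 1 $ j +
      mat2 (1 / X s) 0 0 (X s) $ i $ 2 * rep K (X s) (T s) w $ 2 $ j =
      rep K (X s) (T s) (inv\<^bsub>F2\<^esub> gen_X \<otimes>\<^bsub>F2\<^esub> w) $ i $ j" if "s \<in> S" for s
    using S[OF that] X_inv by (simp add: rep_mult rep_X_inv matrix_mult_nth2)
  ultimately show ?case by (rule rational_on_cong)
next
  case (Y w)
  define M where "M = (\<lambda>s. mat2 (T s) (1 / X s * (1 / X s * (1 / T s)))
    (gam K (X s) * T s) (del K (X s) * (1 / T s)))"
  have "rational_on S (\<lambda>s. M s $ i $ 1 * rep K (X s) (T s) w $ 1 $ j +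
      M s $ i $ 2 * rep K (X s) (T s) w $ 2 $ j)"
    using exhaust_2[of i] unfolding M_def
    by (elim disjE; simp only: mat2_nth)
      (intro rational_on_add rational_on_mult rational_on_const r Y.IH)+
  moreover have "M s $ i $ 1 * rep K (X s) (T s) w $ 1 $ j +
      M s $ i $ 2 * rep K (X s) (T s) w $ 2 $ j =
      rep K (X s) (T s) (gen_Y \<otimes>\<^bsub>F2\<^esub> w) $ i $ j" if "s \<in> S" for s
    using S[OF that] Y by (simp add: rep_mult rep_Y matrix_mult_nth2 M_def mat_Y_def power2_eq_square mult.assoc)
  ultimately show ?case by (rule rational_on_cong)
next
  case (Y_inv w)
  define M where "M = (\<lambda>s. mat2 (del K (X s) * (1 / T s)) (- (1 / X s * (1 / X s * (1 / T s))))
    (- (gam K (X s) * T s)) (T s))"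
  have "rational_on S (\<lambda>s. M s $ i $ 1 * rep K (X s) (T s) w $ 1 $ j +
      M s $ i $ 2 * rep K (X s) (T s) w $ 2 $ j)"
    using exhaust_2[of i] unfolding M_def
    by (elim disjE; simp only: mat2_nth)
      (intro rational_on_add rational_on_mult rational_on_minus rational_on_const r Y_inv.IH)+
  moreover have "M s $ i $ 1 * rep K (X s) (T s) w $ 1 $ j +
      M s $ i $ 2 * rep K (X s) (T s) w $ 2 $ j =
      rep K (X s) (T s) (inv\<^bsub>F2\<^esub> gen_Y \<otimes>\<^bsub>F2\<^esub> w) $ i $ j" if "s \<in> S" for s
    using S[OF that] Y_inv by (simp add: rep_mult rep_Y_inv matrix_mult_nth2 M_def power2_eq_square mult.assoc)
  ultimately show ?case by (rule rational_on_cong)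
qed

lemma square_gt_1: "x > 1 \<Longrightarrow> x\<^sup>2 > (1::real)"
  by (rule one_less_power) auto

text \<open>The sum of the squares of the four expressions in \<open>pm_mat_1_iff\<close>, so that
  triviality in PSL(2) is the vanishing of one rational function.\<close>

definition defect :: "real^2^2 \<Rightarrow> real" where
  "defect A = A$1$2 * A$1$2 + A$2$1 * A$2$1 + (A$1$1 - A$2$2) * (A$1$1 - A$2$2)
     + (A$1$1 * A$1$1 - 1) * (A$1$1 * A$1$1 - 1)"

lemma defect_eq_0_iff: "defect A = 0 \<longleftrightarrow> A = mat 1 \<or> A = - mat 1"
proof -
  have "a * a + b * b + c * c + d * d = 0 \<longleftrightarrow> a = 0 \<and> b = 0 \<and> c = 0 \<and> d = 0" for a b c d :: real
    by (auto simp: add_nonneg_eq_0_iff)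
  then show ?thesis unfolding defect_def pm_mat_1_iff by blast
qed

lemma rational_on_defect:
  assumes "\<And>i j. rational_on S (\<lambda>s. M s $ i $ j)"
  shows "rational_on S (\<lambda>s. defect (M s))"
  unfolding defect_def
  by (intro rational_on_add rational_on_mult rational_on_diff rational_on_const assms)

text \<open>One variable at a time: for each x in \<open>A\<close>, vanishing on \<open>B\<close>
  spreads to all t > 0; then, at the given t, vanishing on \<open>A\<close> spreads to all x >
  1.\<close>

lemma relation_rigid:
  assumes A: "infinite A" "A \<subseteq> {1<..}" and B: "infinite B" "B \<subseteq> {0<..}"
    and w: "w \<in> carrier F2"
    and triv: "\<And>x t. x \<in> A \<Longrightarrow> t \<in> B \<Longrightarrow> rep K x t w = mat 1 \<or> rep K x t w = - mat 1"
    and xt: "x > 1" "t > 0"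
  shows "rep K x t w = mat 1 \<or> rep K x t w = - mat 1"
proof -
  have 1: "rational_on {0<..} (\<lambda>t. defect (rep K x t w))" if x: "x > 1" for x
  proof (intro rational_on_defect rational_on_rep[OF _ _ _ _ _ _ _ w] rational_on_const rational_on_ident)
    show "rational_on {0<..} (\<lambda>s::real. 1 / s)"
      by (rule rational_onI[of _ "[:0, 1:]" _ 1]) auto
  qed (use x in auto)
  have 2: "rational_on {1<..} (\<lambda>x. defect (rep K x t w))" if t: "t > 0" for t
  proof (intro rational_on_defect rational_on_rep[OF _ _ _ _ _ _ _ w] rational_on_const rational_on_ident)
    show "rational_on {1<..} (\<lambda>s::real. 1 / s)"
      by (rule rational_onI[of _ "[:0, 1:]" _ 1]) auto
    have pe: "poly ([:-1, 0, 1:] ^ 2) x = (x\<^sup>2 - 1)\<^sup>2" for x :: real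
      by (simp add: power2_eq_square algebra_simps)
    have ne: "poly ([:-1, 0, 1:] ^ 2) x \<noteq> 0" if "x \<in> {1<..}" for x :: real
    proof -
      have "x\<^sup>2 > 1" using that by (intro square_gt_1) simp
      then show ?thesis unfolding pe by simp
    qed
    show "rational_on {1<..} (gam K)"
      by (rule rational_onI[of _ "[:-1, 0, 1:] ^ 2" _ "monom K 4"])
        (rule ne, simp, simp only: pe gam_def poly_monom)
    have "rational_on {1<..} (\<lambda>x. K * x\<^sup>2 / (x\<^sup>2 - 1)\<^sup>2)"
      by (rule rational_onI[of _ "[:-1, 0, 1:] ^ 2" _ "monom K 2"])
        (rule ne, simp, simp only: pe poly_monom)
    then show "rational_on {1<..} (del K)"
      using rational_on_add[OF rational_on_const[of _ 1]] by (simp add: del_def[abs_def])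
  qed (use t in auto)
  have "defect (rep K x' t w) = 0" if "x' \<in> A" for x'
  proof (rule rational_on_zero[OF 1 B])
    show "x' > 1" using that A by auto
    show "defect (rep K x' s w) = 0" if "s \<in> B" for s
      using triv[OF \<open>x' \<in> A\<close> that] by (simp add: defect_eq_0_iff)
  qed (use xt in simp)
  then have "defect (rep K x t w) = 0"
    using rational_on_zero[OF 2 A] xt by simp
  then show ?thesis by (simp add: defect_eq_0_iff)
qed


section \<open>The Fricke--Klein space\<close>

text \<open>The traces of \<open>mat_X x\<close>, \<open>mat_Y K x t\<close> and their
  product.\<close>

definition fk_point :: "real \<Rightarrow> real \<times> real \<Rightarrow> real \<times> real \<times> real" where
  "fk_point K = (\<lambda>(x, t). (x + 1 / x, t + del K x / t, x * t + del K x / (x * t)))"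

lemma del_gt_1:
  assumes "K > 0" "x > 1"
  shows "del K x > 1"
proof -
  have "K * x\<^sup>2 / (x\<^sup>2 - 1)\<^sup>2 > 0"
    using assms square_gt_1[OF assms(2)] by (intro divide_pos_pos mult_pos_pos zero_less_power) auto
  then show ?thesis by (simp add: del_def)
qed

lemma add_quotient_gt_2:
  assumes "c > 1" "t > (0::real)"
  shows "t + c / t > 2"
proof -
  have "t * t - 2 * t + c > 0"
    using assms zero_le_square[of "t - 1"] by (simp add: algebra_simps)
  then show ?thesis using assms by (simp add: field_simps)
qed

lemma del_eq:
  assumes "x > 1"
  shows "(del K x - 1) * (x - 1 / x)\<^sup>2 = K"
proof -
  have "x - 1 / x = (x\<^sup>2 - 1) / x" using assms by (simp add: power2_eq_square field_simps)
  moreover have "x\<^sup>2 \<noteq> 1" using square_gt_1[OF assms] by simp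
  ultimately show ?thesis using assms by (simp add: del_def power_divide)
qed

lemma fk_point_in:
  assumes K: "K = 2 + 2 * cos (\<theta> / 2)" "K > 0" and x: "x > 1" and t: "t > 0"
  shows "fk_point K (x, t) \<in> fricke_klein \<theta>"
proof -
  define s where "s = del K x / t"
  define y where "y = 1 / x"
  have xy: "x * y = 1" using x by (simp add: y_def)
  have ts: "(t * s - 1) * (x - y)\<^sup>2 = K"
    using del_eq[OF x, of K] t by (simp add: s_def y_def)
  \<comment> \<open>Both sides are the trace of the commutator: on the left by the Fricke identity,
    on the right in the eigenbasis of X, where t and s are the diagonal entries of Y.\<close>
  have "(x + y)\<^sup>2 + (t + s)\<^sup>2 + (x * t + y * s)\<^sup>2 - (x + y) * (t + s) * (x * t + y * s) - 2
      = 2 - (t * s - 1) * (x - y)\<^sup>2"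
    using xy by algebra
  then have eq: "(x + y)\<^sup>2 + (t + s)\<^sup>2 + (x * t + y * s)\<^sup>2 - (x + y) * (t + s) * (x * t + y * s) - 2
      = - 2 * cos (\<theta> / 2)"
    using ts K(1) by simp
  have fk: "fk_point K (x, t) = (x + y, t + s, x * t + y * s)"
    by (simp add: fk_point_def y_def s_def)
  have "x * x - 2 * x + 1 > 0"
    using x zero_less_mult_iff[of "x - 1" "x - 1"] by (simp add: algebra_simps)
  then have "x + y > 2" using x by (simp add: y_def field_simps)
  moreover have "t + s > 2" unfolding s_def by (rule add_quotient_gt_2[OF del_gt_1[OF K(2) x] t])
  moreover have "x * t + y * s > 2"
    using add_quotient_gt_2[OF del_gt_1[OF K(2) x], of "x * t"] x t by (simp add: s_def y_def)
  ultimately show ?thesis using eq by (simp add: fk fricke_klein_def)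
qed

text \<open>The first trace determines the eigenvalue x > 1. The other two are then linear equations
  for the diagonal entries t and s of Y, solvable because x differs from 1/x, and the equation of
  the surface gives ts = \<open>del K x\<close>.\<close>

lemma fk_point_onto:
  assumes K: "K = 2 + 2 * cos (\<theta> / 2)" "K > 0" and \<xi>: "\<xi> \<in> fricke_klein \<theta>"
  obtains x t where "x > 1" "t > 0" "fk_point K (x, t) = \<xi>"
proof -
  obtain a b c where abc: "\<xi> = (a, b, c)" "a > 2" "b > 2" "c > 2"
    "a\<^sup>2 + b\<^sup>2 + c\<^sup>2 - a * b * c - 2 = - 2 * cos (\<theta> / 2)"
    using \<xi> by (cases \<xi>) (auto simp: fricke_klein_def)
  define x where "x = zeta_of a"
  define y where "y = 1 / x"
  have x1: "x \<ge> 1" and a: "x + y = a"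
    using zeta_of_eq(2,3)[of a] abc(2) by (simp_all add: x_def y_def inverse_eq_divide)
  then have x: "x > 1" using abc(2) by (cases "x = 1") (auto simp: y_def)
  then have xy: "x * y = 1" and d: "x - y > 0"
    using square_gt_1[OF x] by (simp_all add: y_def field_simps power2_eq_square)
  define t where "t = (c - b * y) / (x - y)"
  define s where "s = (x * b - c) / (x - y)"
  have t: "t * (x - y) = c - b * y" and s: "s * (x - y) = x * b - c"
    using d by (simp_all add: t_def s_def)
  have "(t + s) * (x - y) = b * (x - y)" using t s by (simp add: algebra_simps)
  then have b: "t + s = b" using d by simp
  have "(x * t + y * s) * (x - y) = x * (c - b * y) + y * (x * b - c)"
    unfolding t[symmetric] s[symmetric] by (simp add: algebra_simps)
  also have "\<dots> = c * (x - y)" by (simp add: algebra_simps)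
  finally have c: "x * t + y * s = c" using d by simp
  have "(x + y)\<^sup>2 + (t + s)\<^sup>2 + (x * t + y * s)\<^sup>2 - (x + y) * (t + s) * (x * t + y * s) - 2
      = 2 - (t * s - 1) * (x - y)\<^sup>2"
    using xy by algebra
  then have "(t * s - 1) * (x - y)\<^sup>2 = K" using abc(5) K(1) by (simp add: a b c)
  then have "(t * s - 1) * (x - y)\<^sup>2 = (del K x - 1) * (x - y)\<^sup>2"
    using del_eq[OF x, of K] by (simp add: y_def)
  then have ts: "t * s = del K x" using d by simp
  then have "t * s > 0" using del_gt_1[OF K(2) x] by simp
  \<comment> \<open>Positive product and positive sum.\<close>
  then have t0: "t > 0" using b abc(3) by (auto simp: zero_less_mult_iff)
  have "fk_point K (x, t) = \<xi>"
    using t0 x a b c by (simp add: fk_point_def abc(1) y_def flip: ts)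
  then show ?thesis using that x t0 by blast
qed

lemma continuous_fk_point: "continuous_on ({1<..} \<times> {0<..}) (fk_point K)"
  unfolding fk_point_def del_def case_prod_beta
proof (intro continuous_intros ballI)
  fix p :: "real \<times> real" assume "p \<in> {1<..} \<times> {0<..}"
  then have p: "fst p > 1" "snd p > 0" by auto
  show "((fst p)\<^sup>2 - 1)\<^sup>2 \<noteq> 0" using square_gt_1[OF p(1)] by simp
qed (auto dest: square_gt_1)

text \<open>The strict bounds may be relaxed: if one coordinate is 2 and the others are a, b, the
  left side of the equation is (a - b)^2 + 2, which exceeds -2 cos(theta/2). Closedness makes the
  Baire theorem applicable.\<close>

lemma closed_fricke_klein:
  assumes "cos (\<theta> / 2) > - 1"
  shows "closed (fricke_klein \<theta>)"
proof -
  define S where "S = {p :: real \<times> real \<times> real. 2 \<le> fst p \<and> 2 \<le> fst (snd p) \<and> 2 \<le> snd (snd p) \<and>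
    (fst p)\<^sup>2 + (fst (snd p))\<^sup>2 + (snd (snd p))\<^sup>2 - fst p * fst (snd p) * snd (snd p) - 2 = - 2 * cos (\<theta> / 2)}"
  have ne: "x \<noteq> 2 \<and> y \<noteq> 2 \<and> z \<noteq> 2"
    if "x\<^sup>2 + y\<^sup>2 + z\<^sup>2 - x * y * z - 2 = - 2 * cos (\<theta> / 2)" for x y z :: real
  proof -
    have "4 + a\<^sup>2 + b\<^sup>2 - 2 * a * b - 2 \<noteq> - 2 * cos (\<theta> / 2)" for a b :: real
      using assms zero_le_power2[of "a - b"] by (simp add: power2_diff)
    from this[of y z] this[of x z] this[of x y] show ?thesis
      using that by (auto simp: algebra_simps)
  qed
  have "fricke_klein \<theta> = S"
    using ne by (force simp: fricke_klein_def S_def)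
  moreover have "closed S" unfolding S_def
    by (intro closed_Collect_conj closed_Collect_le closed_Collect_eq continuous_intros)
  ultimately show ?thesis by simp
qed

section \<open>The holonomy as a function on the surface and its comparison with
  \<open>rep\<close>\<close>

lemma holonomy_lift_hom: "\<xi> \<in> fricke_klein \<theta> \<Longrightarrow> holonomy_lift \<xi> \<in> hom F2 SL2R"
  by (auto simp: fricke_klein_def intro!: holonomy_lift(1))

lemma holonomy_lift_mult:
  assumes "\<xi> \<in> fricke_klein \<theta>" "v \<in> carrier F2" "w \<in> carrier F2"
  shows "holonomy_lift \<xi> (v \<otimes>\<^bsub>F2\<^esub> w) = holonomy_lift \<xi> v ** holonomy_lift \<xi> w"
  using hom_mult[OF holonomy_lift_hom[OF assms(1)] assms(2,3)] by simp

lemma holonomy_lift_one: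
  assumes "\<xi> \<in> fricke_klein \<theta>"
  shows "holonomy_lift \<xi> \<one>\<^bsub>F2\<^esub> = mat 1"
  using hom_one[OF holonomy_lift_hom[OF assms] group_presented_group group_SL2R] by simp

lemma holonomy_lift_inv:
  assumes "\<xi> \<in> fricke_klein \<theta>" "w \<in> carrier F2"
  shows "holonomy_lift \<xi> (inv\<^bsub>F2\<^esub> w) = mat2 (holonomy_lift \<xi> w $ 2 $ 2) (- holonomy_lift \<xi> w $ 1 $ 2)
      (- holonomy_lift \<xi> w $ 2 $ 1) (holonomy_lift \<xi> w $ 1 $ 1)"
proof -
  interpret group_hom F2 SL2R "holonomy_lift \<xi>"
    by unfold_locales (rule holonomy_lift_hom[OF assms(1)])
  have "det (holonomy_lift \<xi> w) = 1"
    using hom_closed[OF assms(2)] by simp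
  then show ?thesis using hom_inv[OF assms(2)] inv_SL2R by simp
qed

lemma continuous_holonomy_lift:
  assumes "w \<in> carrier F2"
  shows "continuous_on (fricke_klein \<theta>) (\<lambda>\<xi>. holonomy_lift \<xi> w $ i $ j)"
proof -
  let ?F = "fricke_klein \<theta>"
  define C where "C = (\<lambda>w. \<forall>i j. continuous_on ?F (\<lambda>\<xi>. holonomy_lift \<xi> w $ i $ j))"
  have gen: "C g" if "g \<in> {gen_X, gen_Y}" for g
  proof -
    have X: "holonomy_lift \<xi> gen_X = mat2 (fst \<xi>) (- 1) 1 0"
      and Y: "holonomy_lift \<xi> gen_Y = mat2 0 (inverse ((snd (snd \<xi>) + sqrt ((snd (snd \<xi>))\<^sup>2 - 4)) / 2))
        (- ((snd (snd \<xi>) + sqrt ((snd (snd \<xi>))\<^sup>2 - 4)) / 2)) (fst (snd \<xi>))"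
      and pos: "(snd (snd \<xi>) + sqrt ((snd (snd \<xi>))\<^sup>2 - 4)) / 2 \<noteq> 0"
      if \<xi>F: "\<xi> \<in> ?F" for \<xi>
    proof -
      obtain x y z where \<xi>: "\<xi> = (x, y, z)" "z \<ge> 2"
        using \<xi>F by (cases \<xi>) (auto simp: fricke_klein_def)
      show "holonomy_lift \<xi> gen_X = mat2 (fst \<xi>) (- 1) 1 0"
        using holonomy_lift(2)[OF \<xi>(2)] by (simp add: \<xi>(1) mat2_def)
      show "holonomy_lift \<xi> gen_Y = mat2 0 (inverse ((snd (snd \<xi>) + sqrt ((snd (snd \<xi>))\<^sup>2 - 4)) / 2))
        (- ((snd (snd \<xi>) + sqrt ((snd (snd \<xi>))\<^sup>2 - 4)) / 2)) (fst (snd \<xi>))"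
        using holonomy_lift(3)[OF \<xi>(2)] zeta_of_eq(1)[OF \<xi>(2)] by (simp add: \<xi>(1) mat2_def)
      show "(snd (snd \<xi>) + sqrt ((snd (snd \<xi>))\<^sup>2 - 4)) / 2 \<noteq> 0"
        using zeta_of_eq(1,2)[OF \<xi>(2)] by (simp add: \<xi>(1))
    qed
    have "continuous_on ?F (\<lambda>\<xi>. mat2 (fst \<xi>) (- 1) 1 0 $ i $ j)" for i j
      using exhaust_2[of i] exhaust_2[of j]
      by (elim disjE; simp only: mat2_nth; intro continuous_intros)
    then have CX: "C gen_X" by (simp add: C_def X cong: continuous_on_cong)
    have "continuous_on ?F (\<lambda>\<xi>. mat2 0 (inverse ((snd (snd \<xi>) + sqrt ((snd (snd \<xi>))\<^sup>2 - 4)) / 2))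
        (- ((snd (snd \<xi>) + sqrt ((snd (snd \<xi>))\<^sup>2 - 4)) / 2)) (fst (snd \<xi>)) $ i $ j)" for i j
      using exhaust_2[of i] exhaust_2[of j]
      by (elim disjE; simp only: mat2_nth; intro continuous_intros ballI pos) auto
    then have CY: "C gen_Y" by (simp add: C_def Y cong: continuous_on_cong)
    show ?thesis using that CX CY by blast
  qed
  have "C w" using assms unfolding F2_generated
  proof (induction w rule: generate.induct)
    case one
    then show ?case
      unfolding C_def by (auto simp: holonomy_lift_one cong: continuous_on_cong)
  next
    case (inv w)
    then have w: "w \<in> carrier F2" and C: "C w" using gen by auto
    show ?case unfolding C_def
    proof (intro allI)
      fix i j :: 2
      have "continuous_on ?F (\<lambda>\<xi>. mat2 (holonomy_lift \<xi> w $ 2 $ 2) (- holonomy_lift \<xi> w $ 1 $ 2)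
          (- holonomy_lift \<xi> w $ 2 $ 1) (holonomy_lift \<xi> w $ 1 $ 1) $ i $ j)"
        using exhaust_2[of i] exhaust_2[of j]
        by (elim disjE; simp only: mat2_nth; intro continuous_on_minus C[unfolded C_def, rule_format])
      then show "continuous_on ?F (\<lambda>\<xi>. holonomy_lift \<xi> (inv\<^bsub>F2\<^esub> w) $ i $ j)"
        using w by (simp add: holonomy_lift_inv cong: continuous_on_cong)
    qed
  next
    case (eng v w)
    then have vw: "v \<in> carrier F2" "w \<in> carrier F2" by (simp_all add: F2_generated)
    show ?case unfolding C_def
    proof (intro allI)
      fix i j :: 2
      have "continuous_on ?F (\<lambda>\<xi>. holonomy_lift \<xi> v $ i $ 1 * holonomy_lift \<xi> w $ 1 $ j +
          holonomy_lift \<xi> v $ i $ 2 * holonomy_lift \<xi> w $ 2 $ j)"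
        by (intro continuous_on_add continuous_on_mult eng.IH[unfolded C_def, rule_format])
      then show "continuous_on ?F (\<lambda>\<xi>. holonomy_lift \<xi> (v \<otimes>\<^bsub>F2\<^esub> w) $ i $ j)"
        using vw by (simp add: holonomy_lift_mult matrix_mult_nth2 cong: continuous_on_cong)
    qed
  qed (rule gen)
  then show ?thesis by (simp add: C_def)
qed

text \<open>The columns of \<open>P\<close> are eigenvectors of \<open>holonomy_X\<close>, the second one scaled so that the lower
  left entry of the conjugate of \<open>holonomy_Y\<close> comes out right.\<close>

lemma intertwiner:
  assumes K: "K = 2 + 2 * cos (\<theta> / 2)" "K > 0" and x: "x > 1" and t: "t > 0"
  obtains P where "invertible P"
    "holonomy_X (fk_point K (x, t)) ** P = P ** mat_X x"
    "holonomy_Y (fk_point K (x, t)) ** P = P ** mat_Y K x t"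
proof -
  define y where "y = 1 / x"
  define q where "q = del K x / t"
  define z where "z = x * t + y * q"
  define b where "b = del K x - 1"
  define \<zeta> where "\<zeta> = zeta_of z"
  define w where "w = inverse \<zeta>"
  have fk: "fk_point K (x, t) = (x + y, t + q, z)"
    by (simp add: fk_point_def y_def q_def z_def)
  have "z > 2" using fk_point_in[OF K x t] by (simp add: fk fricke_klein_def)
  then have "\<zeta> \<ge> 1" and zeq: "\<zeta> + w = z"
    using zeta_of_eq(2,3)[of z] by (simp_all add: \<zeta>_def w_def)
  then have zw: "\<zeta> * w = 1" by (simp add: w_def)
  have xy: "x * y = 1" using x by (simp add: y_def)
  have tq: "t * q = 1 + b" using t by (simp add: q_def b_def)
  have b: "b > 0" using del_gt_1[OF K(2) x] by (simp add: b_def)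
  define g where "g = b * x\<^sup>2"
  have gam: "gam K x = g"
    by (simp add: gam_def g_def b_def del_def power2_eq_square power4_eq_xxxx)
  have gt0: "g * t \<noteq> 0" using b x t by (simp add: g_def)
  define s where "s = (x * w - t * x\<^sup>2) / (g * t)"
  have s: "s * (g * t) = x * w - t * x\<^sup>2" using gt0 by (simp add: s_def)
  \<comment> \<open>Uses that \<open>w\<close> is a root of w^2 - z w + 1.\<close>
  have "(x * w - t * x\<^sup>2) * (w - y * q) = x * b"
    using xy zw zeq tq unfolding z_def by algebra
  then have "s * (w - y * q) * t * g = (y * x) * x * b"
    using xy s by algebra
  then have "(s * (w - y * q) * t) * g = y * g" unfolding g_def by algebra
  \<comment> \<open>This relation shows that \<open>s\<close> is not 0 and later gives the second
    column of the intertwining identity for Y.\<close>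
  then have s2: "s * (w - y * q) * t = y" using gt0 by simp
  then have s0: "s \<noteq> 0" using x by (auto simp: y_def)
  define P where "P = mat2 x (s * y) 1 s"
  have "x - y \<noteq> 0" using square_gt_1[OF x] x by (simp add: y_def field_simps power2_eq_square)
  moreover have "det P = s * (x - y)" by (simp add: P_def algebra_simps)
  ultimately have "det P \<noteq> 0" using s0 by simp
  then have "invertible P" by (simp add: invertible_det_nz)
  moreover have "holonomy_X (fk_point K (x, t)) = mat2 (x + y) (- 1) 1 0"
    by (simp add: fk holonomy_X_def mat2_def)
  moreover have "mat2 (x + y) (- 1) 1 0 ** P = P ** mat_X x"
    unfolding P_def mat_X_def y_def[symmetric]
    by (intro mat2_eqI; simp only: matrix_mult_nth2 mat2_nth) (use xy in algebra)+
  moreover have "holonomy_Y (fk_point K (x, t)) = mat2 0 w (- \<zeta>) (t + q)"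
    by (simp add: fk holonomy_Y_def mat2_def w_def \<zeta>_def)
  moreover have "mat2 0 w (- \<zeta>) (t + q) ** P = P ** mat_Y K x t"
  proof -
    define r where "r = 1 / t"
    have tr: "t * r = 1" using t by (simp add: r_def)
    have Y: "mat_Y K x t = mat2 t (y * y * r) (g * t) q"
      by (simp add: mat_Y_def gam q_def y_def r_def power2_eq_square)
    note zeq' = zeq[unfolded z_def]
    have "s * y * (g * t) = y * (x * w - t * x\<^sup>2)" using s by algebra
    then have 11: "w = x * t + s * y * (g * t)" using xy by algebra
    have "x * w - t * x\<^sup>2 = q - \<zeta> * x" using xy zeq' by algebra
    then have 21: "- \<zeta> * x + (t + q) = t + s * (g * t)" using s by algebra
    have "s * (w - y * q) * t * r = s * (w - y * q)" by (simp add: tr mult.assoc)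
    then have s3: "s * (w - y * q) = y * r" unfolding s2 by simp
    then have 12: "w * s = x * (y * y * r) + s * y * q" using xy by algebra
    have "t - \<zeta> * y = y * (w - y * q)" using xy zeq' by algebra
    then have 22: "- \<zeta> * (s * y) + (t + q) * s = y * y * r + s * q" using s3 by algebra
    show ?thesis unfolding P_def Y
      using 11 21 12 22 by (intro mat2_eqI) (simp_all add: matrix_mult_nth2)
  qed
  ultimately show ?thesis using that by simp
qed

text \<open>The intertwining matrix extends from the generators to all words, and the two matrices
  \<open>mat 1\<close> and \<open>- mat 1\<close> are unchanged by conjugation.\<close>

lemma holonomy_lift_trivial:
  assumes K: "K = 2 + 2 * cos (\<theta> / 2)" "K > 0" and x: "x > 1" and t: "t > 0"
    and w: "w \<in> carrier F2"
    and triv: "holonomy_lift (fk_point K (x, t)) w = mat 1 \<or> holonomy_lift (fk_point K (x, t)) w = - mat 1"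
  shows "rep K x t w = mat 1 \<or> rep K x t w = - mat 1"
proof -
  let ?\<xi> = "fk_point K (x, t)"
  let ?L = "holonomy_lift ?\<xi>"
  have F: "?\<xi> \<in> fricke_klein \<theta>" by (rule fk_point_in[OF K x t])
  obtain P where P: "invertible P" "holonomy_X ?\<xi> ** P = P ** mat_X x"
    "holonomy_Y ?\<xi> ** P = P ** mat_Y K x t"
    using intertwiner[OF K x t] .
  have "?L gen_X = holonomy_X ?\<xi>" "?L gen_Y = holonomy_Y ?\<xi>"
    using F holonomy_lift(2,3) by (auto simp: fricke_klein_def holonomy_X_def holonomy_Y_def)
  then have gen: "?L g ** P = P ** rep K x t g" if "g \<in> {gen_X, gen_Y}" for g
    using that P(2,3) x t by (auto simp: rep_X rep_Y)
  have "?L w ** P = P ** rep K x t w"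
    using w unfolding F2_generated
  proof (induction w rule: generate.induct)
    case one
    then show ?case using F x t by (simp add: holonomy_lift_one rep_one)
  next
    case (inv g)
    then have g: "g \<in> carrier F2" by auto
    have 1: "?L (inv\<^bsub>F2\<^esub> g) ** ?L g = mat 1"
      using g F by (simp add: holonomy_lift_one flip: holonomy_lift_mult)
    have 2: "rep K x t g ** rep K x t (inv\<^bsub>F2\<^esub> g) = mat 1"
      using g x t by (simp add: rep_one flip: rep_mult)
    have "?L (inv\<^bsub>F2\<^esub> g) ** P = ?L (inv\<^bsub>F2\<^esub> g) ** P ** (rep K x t g ** rep K x t (inv\<^bsub>F2\<^esub> g))"
      by (simp add: 2)
    also have "\<dots> = ?L (inv\<^bsub>F2\<^esub> g) ** (P ** rep K x t g) ** rep K x t (inv\<^bsub>F2\<^esub> g)"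
      by (simp only: matrix_mul_assoc)
    also have "\<dots> = ?L (inv\<^bsub>F2\<^esub> g) ** (?L g ** P) ** rep K x t (inv\<^bsub>F2\<^esub> g)"
      by (simp only: gen[OF inv])
    also have "\<dots> = (?L (inv\<^bsub>F2\<^esub> g) ** ?L g) ** P ** rep K x t (inv\<^bsub>F2\<^esub> g)"
      by (simp only: matrix_mul_assoc)
    also have "\<dots> = P ** rep K x t (inv\<^bsub>F2\<^esub> g)" by (simp add: 1)
    finally show ?case .
  next
    case (eng v w)
    then have vw: "v \<in> carrier F2" "w \<in> carrier F2" by (simp_all add: F2_generated)
    have "?L (v \<otimes>\<^bsub>F2\<^esub> w) ** P = ?L v ** (?L w ** P)"
      using vw F by (simp add: holonomy_lift_mult matrix_mul_assoc)
    also have "\<dots> = (?L v ** P) ** rep K x t w"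
      by (simp only: eng.IH(2)) (simp only: matrix_mul_assoc)
    also have "\<dots> = P ** rep K x t v ** rep K x t w" by (simp only: eng.IH(1))
    also have "\<dots> = P ** rep K x t (v \<otimes>\<^bsub>F2\<^esub> w)"
      using vw x t by (simp add: rep_mult matrix_mul_assoc)
    finally show ?case .
  qed (rule gen)
  then have e: "P ** rep K x t w = P \<or> P ** rep K x t w = - P"
    using triv by (auto simp: neg_matrix_mul)
  have "rep K x t w = matrix_inv P ** (P ** rep K x t w)"
    using matrix_inv_mult(2)[OF P(1)] by (simp add: matrix_mul_assoc)
  then show ?thesis using e matrix_inv_mult(2)[OF P(1)] by (auto simp: neg_matrix_mul)
qed

lemma faithful_imp_mon:
  assumes \<xi>: "\<xi> \<in> fricke_klein \<theta>" and \<rho>: "\<rho> \<in> holonomies \<xi>"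
    and faithful: "\<And>w. w \<in> carrier F2 \<Longrightarrow> w \<noteq> \<one>\<^bsub>F2\<^esub> \<Longrightarrow>
      holonomy_lift \<xi> w \<noteq> mat 1 \<and> holonomy_lift \<xi> w \<noteq> - mat 1"
  shows "\<rho> \<in> mon F2 PSL2R"
proof -
  obtain x y z where xyz: "\<xi> = (x, y, z)" "z \<ge> 2"
    using \<xi> by (cases \<xi>) (auto simp: fricke_klein_def)
  have hom: "\<rho> \<in> hom F2 PSL2R" using holonomies_hom[OF xyz(2)] \<rho> xyz(1) by simp
  obtain g :: "real^2^2" where g: "invertible g" and
    \<rho>_eq: "\<And>w. w \<in> carrier F2 \<Longrightarrow> \<rho> w = (\<lambda>A. g ** A ** matrix_inv g) ` PSL2R_proj (holonomy_lift \<xi> w)"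
    using \<rho> by (auto simp: holonomies_def)
  have "w = \<one>\<^bsub>F2\<^esub>" if w: "w \<in> carrier F2" "\<rho> w = \<one>\<^bsub>PSL2R\<^esub>" for w
  proof (rule ccontr)
    assume n: "w \<noteq> \<one>\<^bsub>F2\<^esub>"
    let ?A = "holonomy_lift \<xi> w"
    have "g ** ?A ** matrix_inv g \<in> \<rho> w" by (simp add: \<rho>_eq[OF w(1)] PSL2R_proj_eq)
    then have c: "g ** ?A ** matrix_inv g = mat 1 \<or> g ** ?A ** matrix_inv g = - mat 1"
      using w(2) by (simp add: PSL2R_def)
    have "matrix_inv g ** (g ** ?A ** matrix_inv g) ** g =
        (matrix_inv g ** g) ** ?A ** (matrix_inv g ** g)"
      by (simp only: matrix_mul_assoc)
    then have "?A = matrix_inv g ** (g ** ?A ** matrix_inv g) ** g"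
      by (simp add: matrix_inv_mult[OF g])
    with c have "?A = mat 1 \<or> ?A = - mat 1"
      by (metis matrix_inv_mult(2)[OF g] matrix_mul_rid neg_matrix_mul)
    then show False using faithful[OF w(1) n] by blast
  qed
  then show ?thesis
    using hom by (auto simp: mon_iff_hom_one[OF group_presented_group group_PSL2R])
qed

theorem corollary1p3:
  fixes \<theta> :: real
  assumes "0 < \<theta>" "\<theta> < 2 * pi"
    and "algebraic (\<theta> / pi)" "\<theta> / pi \<notin> \<rat>"
  shows "very_general (top_of_set (fricke_klein \<theta>))
           (\<lambda>\<xi>. \<forall>\<rho>\<in>holonomies \<xi>. \<rho> \<in> mon F2 PSL2R)"
proof -
  let ?F = "fricke_klein \<theta>"
  define K where "K = 2 + 2 * cos (\<theta> / 2)"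
  have "cos (\<theta> / 2) > cos pi"
    using assms by (intro cos_monotone_0_pi) auto
  then have cos: "cos (\<theta> / 2) > - 1" by simp
  then have K: "K > 0" by (simp add: K_def)
  interpret irrational_angle "pi - \<theta> / 2" K
  proof
    show "(pi - \<theta> / 2) / pi \<notin> \<rat>"
    proof
      assume "(pi - \<theta> / 2) / pi \<in> \<rat>"
      then have "2 * (1 - (pi - \<theta> / 2) / pi) \<in> \<rat>" by (intro Rats_mult Rats_diff) auto
      moreover have "2 * (1 - (pi - \<theta> / 2) / pi) = \<theta> / pi" by (simp add: field_simps)
      ultimately show False using assms(4) by simp
    qed
    show "K = 2 - 2 * cos (pi - \<theta> / 2)" by (simp add: K_def)
  qed
  define D where "D = (\<lambda>w. {\<xi> \<in> ?F. w \<noteq> \<one>\<^bsub>F2\<^esub> \<longrightarrow> defect (holonomy_lift \<xi> w) \<noteq> 0})"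
  have D_open: "openin (top_of_set ?F) (D w)" if w: "w \<in> carrier F2" for w
  proof (cases "w = \<one>\<^bsub>F2\<^esub>")
    case True
    then show ?thesis by (simp add: D_def)
  next
    case False
    have "continuous_on ?F (\<lambda>\<xi>. defect (holonomy_lift \<xi> w))"
      unfolding defect_def by (intro continuous_intros continuous_holonomy_lift w)
    then have "openin (top_of_set ?F) (?F \<inter> (\<lambda>\<xi>. defect (holonomy_lift \<xi> w)) -` (- {0}))"
      by (rule continuous_openin_preimage_gen) (simp add: open_Compl)
    moreover have "?F \<inter> (\<lambda>\<xi>. defect (holonomy_lift \<xi> w)) -` (- {0}) = D w"
      using False by (auto simp: D_def)
    ultimately show ?thesis by simp
  qed
  have D_dense: "?F \<subseteq> closure (D w)" if w: "w \<in> carrier F2" for w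
  proof (cases "w = \<one>\<^bsub>F2\<^esub>")
    case True
    then show ?thesis by (simp add: D_def closure_subset)
  next
    case False
    obtain x1 t1 where 1: "x1 > 1" "t1 > 0" "rep K x1 t1 w \<noteq> mat 1" "rep K x1 t1 w \<noteq> - mat 1"
      using generically_faithful[OF w False] by blast
    show ?thesis
    proof
      fix \<xi> assume "\<xi> \<in> ?F"
      then obtain x0 t0 where 0: "x0 > 1" "t0 > 0" "fk_point K (x0, t0) = \<xi>"
        using fk_point_onto[OF K_def K] by blast
      show "\<xi> \<in> closure (D w)" unfolding closure_approachable
      proof (intro allI impI)
        fix e :: real assume e: "e > 0"
        define U where "U = ({1<..} \<times> {0<..}) \<inter> fk_point K -` ball \<xi> e"
        have "open U" unfolding U_def
          by (intro continuous_open_preimage continuous_fk_point open_Times) auto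
        moreover have "(x0, t0) \<in> U" using 0 e by (simp add: U_def)
        \<comment> \<open>A neighbourhood of the parameter contains a product of open sets, whose
          factors are the infinite sets for \<open>relation_rigid\<close>.\<close>
        ultimately obtain A B where AB: "open A" "open B" "(x0, t0) \<in> A \<times> B" "A \<times> B \<subseteq> U"
          by (rule open_prod_elim) blast
        then have inf: "infinite A" "infinite B" using finite_imp_not_open by blast+
        have sub: "A \<subseteq> {1<..}" "B \<subseteq> {0<..}" using AB(3,4) by (auto simp: U_def)
        have "\<exists>x\<in>A. \<exists>t\<in>B. rep K x t w \<noteq> mat 1 \<and> rep K x t w \<noteq> - mat 1"
          using relation_rigid[OF inf(1) sub(1) inf(2) sub(2) w, of K x1 t1] 1 by blast
        then obtain x t where xt: "x \<in> A" "t \<in> B" "rep K x t w \<noteq> mat 1" "rep K x t w \<noteq> - mat 1"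
          by blast
        then have x: "x > 1" and t: "t > 0" using sub by auto
        have "fk_point K (x, t) \<in> D w"
          using holonomy_lift_trivial[OF K_def K x t w] fk_point_in[OF K_def K x t] xt
          by (auto simp: D_def defect_eq_0_iff)
        moreover have "dist (fk_point K (x, t)) \<xi> < e"
          using AB(4) xt(1,2) by (auto simp: U_def dist_commute)
        ultimately show "\<exists>\<eta>\<in>D w. dist \<eta> \<xi> < e" by blast
      qed
    qed
  qed
  let ?D = "\<Inter> (D ` carrier F2)"
  have one: "\<one>\<^bsub>F2\<^esub> \<in> carrier F2" by simp
  have sub: "?D \<subseteq> ?F" using one by (auto simp: D_def)
  have "gdelta_in (top_of_set ?F) ?D"
    using one by (intro gdelta_in_Inter countable_image countable_F2)
      (auto intro!: open_imp_gdelta_in D_open)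
  moreover have "?F \<subseteq> closure ?D"
    by (rule Baire[OF closed_fricke_klein[OF cos]])
      (auto intro!: countable_image countable_F2 simp: D_open D_dense[THEN subsetD])
  then have "Abstract_Topology.closure_of (top_of_set ?F) ?D = topspace (top_of_set ?F)"
    using sub by (simp add: closure_of_subtopology Int_absorb1 Int_absorb2)
  moreover have "\<forall>\<rho>\<in>holonomies \<xi>. \<rho> \<in> mon F2 PSL2R" if \<xi>: "\<xi> \<in> ?D" for \<xi>
  proof
    fix \<rho> assume \<rho>: "\<rho> \<in> holonomies \<xi>"
    show "\<rho> \<in> mon F2 PSL2R"
    proof (rule faithful_imp_mon[OF _ \<rho>])
      show "\<xi> \<in> ?F" using \<xi> sub by blast
      show "holonomy_lift \<xi> w \<noteq> mat 1 \<and> holonomy_lift \<xi> w \<noteq> - mat 1"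
        if "w \<in> carrier F2" "w \<noteq> \<one>\<^bsub>F2\<^esub>" for w
        using \<xi> that by (auto simp: D_def defect_eq_0_iff)
    qed
  qed
  ultimately show ?thesis unfolding very_general_def by blast
qed

end
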